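(* Let $G$ be a graph with independence number $\beta_0(G)\leq 2$, and let $\overline{G}$ be its complement. The following hold. (a) $I_c(G)$ is normal if and only if $I(\overline{G})$ is normal. (b) $I_c(G)$ is normal if and only if $\overline{G}$ has no Hochster configurations.
   Context: Graphs are finite, with no multiple edges or loops. The vertices of $G$, $V(G)=\{t_1,\ldots,t_s\}$, are regarded as variables of the polynomial ring $S=K[t_1,\ldots,t_s]$ over a field $K$. The complement $\overline{G}$ has the same vertex set as $G$, and two distinct vertices are adjacent in $\overline{G}$ if and only if they are not adjacent in $G$. $\beta_0(G)$ is the maximum size of a set of vertices containing no edge of $G$. The edge ideal $I(G)$ of a graph is the ideal of $S$ generated by all $\prod_{t_i\in e}t_i$ with $e$ an edge ($I(G)=(0)$ if there are no edges). A vertex cover is a set of vertices meeting every edge; the ideal of covers $I_c(G)$ is the ideal of $S$ generated by all $\prod_{t_i\in C}t_i$ with $C$ an inclusion-minimal vertex cover of $G$ ($I_c(G)=S$ if there are no edges). An ideal $J$ is normal if $J^n=\overline{J^n}$ for all $n\geq 1$, where $\overline{J^n}$ is the integral closure of $J^n$. A Hochster configuration of a graph $H$ consists of two odd cycles $C_1,C_2$ of $H$ such that (i) $C_1\cap N_H(C_2)=\emptyset$, where $N_H(C_2)$ is the set of vertices of $H$ adjacent to some vertex of $C_2$; and (ii) no chord of $C_i$, $i=1,2$, is an edge of $H$, i.e., each $C_i$ is an induced cycle of $H$. *)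

theory Defs
  imports Complex_Main "HOL-Library.Poly_Mapping"
begin

section \<open>Finite simple graphs\<close>

text \<open>
  A graph is given by its set of edges, which are two-element sets of vertices. Its vertex set is
  the whole of the (finite) type \<open>'v\<close>.
\<close>

definition simple_graph :: "'v::finite set set \<Rightarrow> bool" where
  "simple_graph E \<longleftrightarrow> (\<forall>e\<in>E. card e = 2)"

definition complement_graph :: "'v::finite set set \<Rightarrow> 'v set set" where
  "complement_graph E = {{u, v} | u v. u \<noteq> v \<and> {u, v} \<notin> E}"

definition independent_set :: "'v::finite set set \<Rightarrow> 'v set \<Rightarrow> bool" where
  "independent_set E A \<longleftrightarrow> (\<forall>e\<in>E. \<not> e \<subseteq> A)"

definition independence_number :: "'v::finite set set \<Rightarrow> nat" where
  "independence_number E = Max {card A | A. independent_set E A}"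

definition vertex_cover :: "'v::finite set set \<Rightarrow> 'v set \<Rightarrow> bool" where
  "vertex_cover E C \<longleftrightarrow> (\<forall>e\<in>E. e \<inter> C \<noteq> {})"

definition minimal_vertex_cover :: "'v::finite set set \<Rightarrow> 'v set \<Rightarrow> bool" where
  "minimal_vertex_cover E C \<longleftrightarrow> vertex_cover E C \<and> (\<forall>D. D \<subset> C \<longrightarrow> \<not> vertex_cover E D)"

definition neighbours :: "'v::finite set set \<Rightarrow> 'v set \<Rightarrow> 'v set" where
  "neighbours E A = {v. \<exists>u\<in>A. {u, v} \<in> E}"

text \<open>
  A cycle is the list of its vertices in cyclic order; the starting point and the orientation are
  not normalised.
\<close>

definition cycle_edges :: "'v::finite list \<Rightarrow> 'v set set" where
  "cycle_edges c = {{c ! i, c ! (Suc i mod length c)} | i. i < length c}"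

definition is_cycle :: "'v::finite set set \<Rightarrow> 'v list \<Rightarrow> bool" where
  "is_cycle E c \<longleftrightarrow> length c \<ge> 3 \<and> distinct c \<and> cycle_edges c \<subseteq> E"

definition is_chord :: "'v::finite list \<Rightarrow> 'v set \<Rightarrow> bool" where
  "is_chord c e \<longleftrightarrow> card e = 2 \<and> e \<subseteq> set c \<and> e \<notin> cycle_edges c"

definition hochster_configuration :: "'v::finite set set \<Rightarrow> 'v list \<Rightarrow> 'v list \<Rightarrow> bool" where
  "hochster_configuration E c1 c2 \<longleftrightarrow>
     is_cycle E c1 \<and> odd (length c1) \<and> is_cycle E c2 \<and> odd (length c2) \<and>
     set c1 \<inter> neighbours E (set c2) = {} \<and>
     (\<forall>e\<in>E. \<not> is_chord c1 e) \<and> (\<forall>e\<in>E. \<not> is_chord c2 e)"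


section \<open>Ideals of a commutative ring\<close>

text \<open>
  The ideals of a commutative ring are its submodules as a module over itself, so the ideal
  generated by a set is its span.
\<close>

global_interpretation ideal: module "(*) :: 'a::comm_ring_1 \<Rightarrow> 'a \<Rightarrow> 'a"
  defines ideal_generated = ideal.span
  by standard (simp_all add: algebra_simps)

primrec ideal_power :: "'a::comm_ring_1 set \<Rightarrow> nat \<Rightarrow> 'a set" where
  "ideal_power J 0 = UNIV"
| "ideal_power J (Suc n) = ideal_generated {a * b | a b. a \<in> J \<and> b \<in> ideal_power J n}"

text \<open>
  An element \<open>x\<close> is integral over the ideal \<open>J\<close> if
  \<open>x\<^sup>m + a\<^sub>1 x\<^bsup>m-1\<^esup> + \<dots> + a\<^sub>m = 0\<close> for some \<open>m \<ge> 1\<close> and \<open>a\<^sub>i \<in> J\<^sup>i\<close>.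
\<close>

definition integral_closure :: "'a::comm_ring_1 set \<Rightarrow> 'a set" where
  "integral_closure J =
     {x. \<exists>m\<ge>1. \<exists>a. (\<forall>i\<in>{1..m}. a i \<in> ideal_power J i) \<and>
           x ^ m + (\<Sum>i=1..m. a i * x ^ (m - i)) = 0}"

definition normal_ideal :: "'a::comm_ring_1 set \<Rightarrow> bool" where
  "normal_ideal J \<longleftrightarrow> (\<forall>n\<ge>1. ideal_power J n = integral_closure (ideal_power J n))"


section \<open>Edge ideals and ideals of covers\<close>

text \<open>
  The polynomial ring over \<open>'k\<close> in the variables \<open>'v\<close>: finitely supported maps from exponent
  vectors to coefficients, with the convolution product.
\<close>

type_synonym ('v, 'k) polyring = "('v \<Rightarrow>\<^sub>0 nat) \<Rightarrow>\<^sub>0 'k"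

definition var :: "'v \<Rightarrow> ('v, 'k::field) polyring" where
  "var v = Poly_Mapping.single (Poly_Mapping.single v 1) 1"

definition edge_ideal :: "'v::finite set set \<Rightarrow> ('v, 'k::field) polyring set" where
  "edge_ideal E = ideal_generated {\<Prod>v\<in>e. var v | e. e \<in> E}"

definition cover_ideal :: "'v::finite set set \<Rightarrow> ('v, 'k::field) polyring set" where
  "cover_ideal E = ideal_generated {\<Prod>v\<in>C. var v | C. minimal_vertex_cover E C}"

end

theory Submission
  imports Defs "HOL-Combinatorics.Cycles"
begin

text \<open>
  Let \<open>H\<close> be the complement of \<open>G\<close>. Both normality statements are shown to be equivalent to the
  absence of Hochster configurations in \<open>H\<close>; their equivalence to each other is a consequence.

  The exponents \<open>b\<close> of a monomial in the integral closure of a power of a monomial ideal satisfy every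
  linear inequality with nonnegative coefficients that holds on the generators
  (\<open>weight_bound_integral_closure\<close>). Conversely, a monomial is integral as soon as its square is
  in the square of the power. So normality asks whether a fractional combinatorial problem
  always has an integral solution.

  For the edge ideal of \<open>H\<close> the problem is to find \<open>n\<close> edges of \<open>H\<close> that use each vertex \<open>v\<close> at most
  \<open>b v\<close> times. For the cover ideal of \<open>G\<close>, the minimal covers are the complements of the maximal
  cliques of \<open>H\<close>, and since \<open>G\<close> has no three independent vertices, these are edges or single vertices.
  The problem is then to cover each vertex at least \<open>n - b v\<close> times by \<open>n\<close> such cliques. By the
  argument of Gallai's identity this is the same matching problem, with capacities \<open>n - b v\<close> in place
  of \<open>b v\<close>. This is the duality behind the equivalence of the two normality statements.

  Fractional matchings can be taken half-integral, made up of edges and of odd cycles with weight one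
  half. Without a Hochster configuration any two odd cycles are joined by an edge, and two joined odd
  cycles can be replaced by a perfect matching of their union. So at most one odd cycle is
  left, and it costs one half, which does not matter if an integral number of edges is sought. This is
  \<open>integral_matching_if_half_integral_covers_large\<close>. It is proved in the blow-up of \<open>H\<close>, where
  capacities become numbers of copies of the vertices, and half-integrality comes from Konig's theorem
  for the bipartite double cover.

  Conversely, in a Hochster configuration the half-integral solution that takes each edge of the two
  cycles with weight one half cannot be made integral, because a perfect matching of the configuration
  would have to match each of the two odd cycles within itself
  (\<open>hochster_configuration_clique_cover\<close>).
\<close>

section \<open>Minimum covers of a bipartite graph\<close>

text \<open>
  Finiteness is part of the notion because an infinite vertex set has cardinality \<open>0\<close> and would
  pass for the cheapest cover.
\<close>
definition bipartite_cover :: "('a \<times> 'b) set \<Rightarrow> 'a set \<Rightarrow> 'b set \<Rightarrow> bool" where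
  "bipartite_cover R X Y \<longleftrightarrow> finite X \<and> finite Y \<and> (\<forall>(x, y)\<in>R. x \<in> X \<or> y \<in> Y)"

text \<open>
  Covers are submodular. Suppose that two edges \<open>e\<close> and \<open>f\<close> share their left vertex \<open>a\<close>, and take
  covers with fewer than \<open>k\<close> vertices of the graphs without \<open>e\<close> and without \<open>f\<close>. Intersecting
  them on the left and uniting them on the right, and the other way round, gives two vertex sets
  with the same total size. The first covers everything, and so does the second once \<open>a\<close> is
  added. Together these two covers have at least \<open>2k\<close> vertices, but at most \<open>2(k - 1) + 1\<close>.
\<close>
lemma cover_critical_imp_inj_on_fst:
  assumes cover: "\<And>X Y. bipartite_cover R X Y \<Longrightarrow> k \<le> card X + card Y"
    and critical: "\<And>e. e \<in> R \<Longrightarrow> \<exists>X Y. bipartite_cover (R - {e}) X Y \<and> card X + card Y < k"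
  shows "inj_on fst R"
proof (rule inj_onI, rule ccontr)
  fix e f assume "e \<in> R" "f \<in> R" "fst e = fst f" "e \<noteq> f"
  then obtain a b b' where ab: "e = (a, b)" "f = (a, b')" "(a, b) \<in> R" "(a, b') \<in> R" "b \<noteq> b'"
    by (metis prod.collapse)
  obtain X Y where 1: "bipartite_cover (R - {(a, b)}) X Y" "card X + card Y < k"
    using critical[OF ab(3)] by blast
  obtain X' Y' where 2: "bipartite_cover (R - {(a, b')}) X' Y'" "card X' + card Y' < k"
    using critical[OF ab(4)] by blast
  have fin: "finite X" "finite X'" "finite Y" "finite Y'"
    using 1 2 by (auto simp: bipartite_cover_def)
  have "a \<notin> X" "a \<notin> X'"
    using cover[of X Y] cover[of X' Y'] 1 2 by (fastforce simp: bipartite_cover_def)+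
  then have "b' \<in> Y" "b \<in> Y'"
    using ab 1(1) 2(1) by (auto simp: bipartite_cover_def)
  then have "bipartite_cover R (X \<inter> X') (Y \<union> Y')"
    "bipartite_cover R (insert a (X \<union> X')) (Y \<inter> Y')"
    using 1(1) 2(1) unfolding bipartite_cover_def by auto
  then have "k \<le> card (X \<inter> X') + card (Y \<union> Y')" "k \<le> card (insert a (X \<union> X')) + card (Y \<inter> Y')"
    by (auto dest: cover)
  moreover have "card (insert a (X \<union> X')) \<le> Suc (card (X \<union> X'))"
    by (simp add: card_insert_if fin)
  moreover have "card X + card X' = card (X \<union> X') + card (X \<inter> X')"
    "card Y + card Y' = card (Y \<union> Y') + card (Y \<inter> Y')"
    using fin by (simp_all only: card_Un_Int)
  ultimately show False using 1(2) 2(2) by linarith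
qed

text \<open>
  Delete edges as long as every cover has at least \<open>k\<close> vertices. What remains is critical, so by
  the previous lemma and its mirror image no two edges share a vertex: it is a matching. Its left
  end points cover it, so it has at least \<open>k\<close> edges.
\<close>
theorem konig:
  assumes "finite R" and "\<And>X Y. bipartite_cover R X Y \<Longrightarrow> k \<le> card X + card Y"
  shows "\<exists>M\<subseteq>R. inj_on fst M \<and> inj_on snd M \<and> k \<le> card M"
  using assms
proof (induction R rule: finite_psubset_induct)
  case (psubset R)
  show ?case
  proof (cases "\<exists>e\<in>R. \<forall>X Y. bipartite_cover (R - {e}) X Y \<longrightarrow> k \<le> card X + card Y")
    case True
    then obtain e where e: "e \<in> R" "\<And>X Y. bipartite_cover (R - {e}) X Y \<Longrightarrow> k \<le> card X + card Y"
      by blast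
    have "\<exists>M\<subseteq>R - {e}. inj_on fst M \<and> inj_on snd M \<and> k \<le> card M"
      using e by (intro psubset.IH) auto
    then show ?thesis by blast
  next
    case False
    then have critical: "\<exists>X Y. bipartite_cover (R - {e}) X Y \<and> card X + card Y < k" if "e \<in> R" for e
      using that by (meson not_le)
    have converse: "bipartite_cover (R\<inverse> - {prod.swap e}) Y X \<longleftrightarrow> bipartite_cover (R - {e}) X Y"
      "bipartite_cover (R\<inverse>) Y X \<longleftrightarrow> bipartite_cover R X Y" for e X Y
      by (cases e; fastforce simp: bipartite_cover_def)+
    have "inj_on fst R"
      using psubset.prems critical by (rule cover_critical_imp_inj_on_fst)
    moreover have "inj_on fst (R\<inverse>)"
    proof (rule cover_critical_imp_inj_on_fst)
      show "k \<le> card Y + card X" if "bipartite_cover (R\<inverse>) Y X" for X Y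
        using psubset.prems[of X Y] that converse by (simp add: add.commute)
      show "\<exists>Y X. bipartite_cover (R\<inverse> - {e}) Y X \<and> card Y + card X < k" if "e \<in> R\<inverse>" for e
        using critical[of "prod.swap e"] that converse(1)[of "prod.swap e"]
        by (fastforce simp: add.commute)
    qed
    then have "inj_on snd R"
      by (simp add: inj_on_def Ball_def split_paired_All)
    moreover have "bipartite_cover R (fst ` R) {}"
      using psubset.hyps by (force simp: bipartite_cover_def)
    then have "k \<le> card R"
      using psubset.prems \<open>inj_on fst R\<close> by (fastforce simp: card_image)
    ultimately show ?thesis by blast
  qed
qed

section \<open>Perfectly matched vertex sets\<close>

inductive perfectly_matched :: "('a \<Rightarrow> 'a \<Rightarrow> bool) \<Rightarrow> 'a set \<Rightarrow> bool" for adj where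
  empty: "perfectly_matched adj {}"
| insert: "\<lbrakk>perfectly_matched adj Z; adj x y; x \<noteq> y; x \<notin> Z; y \<notin> Z\<rbrakk>
    \<Longrightarrow> perfectly_matched adj (insert x (insert y Z))"

lemma perfectly_matched_imp_finite: "perfectly_matched adj Z \<Longrightarrow> finite Z"
  by (induction rule: perfectly_matched.induct) auto

lemma perfectly_matched_Un:
  assumes "perfectly_matched adj Z" "perfectly_matched adj W" "Z \<inter> W = {}"
  shows "perfectly_matched adj (Z \<union> W)"
  using assms
proof (induction rule: perfectly_matched.induct)
  case (insert Z x y)
  then have "perfectly_matched adj (insert x (insert y (Z \<union> W)))"
    by (intro perfectly_matched.insert) auto
  then show ?case by simp
qed simp

lemma even_path_perfectly_matched:
  assumes "even (length p)" "distinct p" "successively adj p"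
  shows "perfectly_matched adj (set p)"
  using assms
proof (induction p rule: induct_list012)
  case (3 x y zs)
  then have "perfectly_matched adj (set zs)"
    by (cases zs) auto
  with 3 show ?case
    by (auto intro: perfectly_matched.insert)
qed (auto intro: perfectly_matched.empty)


definition closed_walk :: "('a \<Rightarrow> 'a \<Rightarrow> bool) \<Rightarrow> 'a list \<Rightarrow> bool" where
  "closed_walk adj c \<longleftrightarrow> (\<forall>i<length c. adj (c ! i) (c ! (Suc i mod length c)))"

text \<open>
  Cutting a cycle open at a prescribed vertex turns statements about cycles into statements about
  paths.
\<close>
lemma closed_walk_rotate:
  assumes "closed_walk adj c" "distinct c" "a \<in> set c"
  obtains p where "distinct (a # p)" "set (a # p) = set c" "length (a # p) = length c"
    "successively adj (a # p)"
proof -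
  obtain i where i: "i < length c" "c ! i = a"
    using assms(3) by (auto simp: in_set_conv_nth)
  define r where "r = rotate i c"
  have "successively adj r"
    unfolding successively_conv_nth
  proof (intro allI impI)
    fix j assume "Suc j < length r"
    then have "r ! j = c ! ((i + j) mod length c)" "r ! Suc j = c ! (Suc ((i + j) mod length c) mod length c)"
      by (auto simp: r_def nth_rotate mod_Suc_eq)
    moreover have "(i + j) mod length c < length c"
      using i by (intro mod_less_divisor) auto
    ultimately show "adj (r ! j) (r ! Suc j)"
      using assms(1) by (simp add: closed_walk_def)
  qed
  moreover have "r ! 0 = a"
    using i nth_rotate[of 0 c i] by (cases c) (simp_all add: r_def)
  moreover have "distinct r" "set r = set c" "length r = length c"
    using assms(2) by (simp_all add: r_def)
  moreover from this have "r \<noteq> []"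
    using i by auto
  then have "r = r ! 0 # tl r"
    by (cases r) auto
  ultimately show thesis
    using that[of "tl r"] by metis
qed

lemma odd_cycle_minus_vertex_perfectly_matched:
  assumes "closed_walk adj c" "distinct c" "a \<in> set c" "odd (length c)"
  shows "perfectly_matched adj (set c - {a})"
proof -
  obtain p where p: "distinct (a # p)" "set (a # p) = set c" "length (a # p) = length c"
    "successively adj (a # p)"
    using closed_walk_rotate[OF assms(1-3)] .
  have "even (length p)"
    using p(3) assms(4) by (metis even_Suc length_Cons)
  then have "perfectly_matched adj (set p)"
    using p by (intro even_path_perfectly_matched) (auto simp: successively_Cons)
  moreover have "set p = set c - {a}"
    using p by auto
  ultimately show ?thesis by simp
qed

lemma even_cycle_perfectly_matched:
  assumes "closed_walk adj c" "distinct c" "even (length c)"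
  shows "perfectly_matched adj (set c)"
proof (cases "c = []")
  case False
  then obtain p where p: "distinct (hd c # p)" "set (hd c # p) = set c" "length (hd c # p) = length c"
    "successively adj (hd c # p)"
    using closed_walk_rotate[OF assms(1,2)] hd_in_set by metis
  then show ?thesis
    using assms(3) even_path_perfectly_matched[of "hd c # p" adj] by simp
qed (simp add: perfectly_matched.empty)

text \<open>
  This is where a link between two odd cycles pays off: the link matches one vertex of each cycle,
  and the two remaining paths have even numbers of vertices.
\<close>
lemma linked_odd_cycles_perfectly_matched:
  assumes c: "closed_walk adj c" "distinct c" "a \<in> set c" "odd (length c)"
    and c': "closed_walk adj c'" "distinct c'" "b \<in> set c'" "odd (length c')"
    and "set c \<inter> set c' = {}" "adj a b"
  shows "perfectly_matched adj (set c \<union> set c')"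
proof -
  have "perfectly_matched adj ((set c - {a}) \<union> (set c' - {b}))"
    using assms(9) by (intro perfectly_matched_Un odd_cycle_minus_vertex_perfectly_matched c c') auto
  then have "perfectly_matched adj (insert a (insert b ((set c - {a}) \<union> (set c' - {b}))))"
    using assms by (intro perfectly_matched.insert) auto
  also have "insert a (insert b ((set c - {a}) \<union> (set c' - {b}))) = set c \<union> set c'"
    using c(3) c'(3) by auto
  finally show ?thesis .
qed

text \<open>
  An orbit of a finite permutation is a cycle. The function is a permutation only on \<open>E\<close> and
  has to be extended by the identity.
\<close>
lemma orbit_is_closed_walk:
  assumes "finite E" "\<sigma> ` E = E" "x \<in> E" and adj: "\<And>z. z \<in> E \<Longrightarrow> adj z (\<sigma> z)"
  obtains c where "x \<in> set c" "set c \<subseteq> E" "\<sigma> ` set c = set c" "distinct c" "closed_walk adj c"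
proof -
  define \<pi> where "\<pi> = (\<lambda>z. if z \<in> E then \<sigma> z else z)"
  have inj: "inj_on \<sigma> E"
    using assms(1,2) by (simp add: eq_card_imp_inj_on)
  have \<pi>: "\<pi> permutes E"
  proof (rule bij_imp_permutes)
    have "bij_betw \<sigma> E E"
      using inj assms(2) by (simp add: bij_betw_def)
    then show "bij_betw \<pi> E E"
      by (rule bij_betw_cong[THEN iffD1, rotated]) (simp add: \<pi>_def)
  qed (simp add: \<pi>_def)
  then have perm: "permutation \<pi>"
    using assms(1) permutation_permutes by blast
  define L where "L = least_power \<pi> x"
  define c where "c = support \<pi> x"
  have L: "(\<pi> ^^ L) x = x" "L > 0"
    using least_power_of_permutation[OF perm] by (simp_all add: L_def)
  have len: "length c = L"
    by (simp add: c_def L_def)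
  have nth: "c ! i = (\<pi> ^^ i) x" if "i < L" for i
    using that by (simp_all add: c_def L_def)
  have in_E: "(\<pi> ^^ i) x \<in> E" for i
    using permutes_in_image[OF permutes_funpow[OF \<pi>]] assms(3) by blast
  have step: "c ! (Suc i mod L) = \<sigma> (c ! i)" if "i < L" for i
  proof -
    have "c ! (Suc i mod L) = (\<pi> ^^ Suc i) x"
    proof (cases "Suc i = L")
      case True
      then show ?thesis using L nth[of 0] by simp
    next
      case False
      then show ?thesis using that nth[of "Suc i"] by simp
    qed
    also have "\<dots> = \<sigma> ((\<pi> ^^ i) x)"
      using in_E[of i] by (simp add: \<pi>_def)
    finally show ?thesis using nth that by simp
  qed
  have sub: "set c \<subseteq> E"
    using in_E by (auto simp: c_def)
  have "\<sigma> ` set c \<subseteq> set c"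
  proof
    fix z assume "z \<in> \<sigma> ` set c"
    then obtain i where "i < L" "z = \<sigma> (c ! i)"
      using len by (auto simp: in_set_conv_nth)
    then have "z = c ! (Suc i mod L)" "Suc i mod L < length c"
      using step len L(2) by simp_all
    then show "z \<in> set c" by simp
  qed
  then have closed: "\<sigma> ` set c = set c"
    using inj sub by (meson endo_inj_surj inj_on_subset List.finite_set)
  have "x \<in> set c"
    using nth[of 0] len L(2) by (metis funpow_0 nth_mem)
  moreover have "closed_walk adj c"
    unfolding closed_walk_def using step len sub adj by (metis nth_mem subsetD)
  moreover have "distinct c"
    unfolding c_def by (rule cycle_of_permutation[OF perm])
  ultimately show thesis
    using that sub closed by blast
qed

text \<open>
  A partial injection along edges is a matching of the bipartite double cover of the graph, that
  is, twice a half-integral matching. Its components are paths, even cycles and odd cycles. Paths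
  and even cycles can be replaced by honest matchings that are at least as large, and so can two
  odd cycles joined by an edge. When all pairs of odd cycles are joined, at most one odd cycle
  resists, and it costs a single vertex.

  The replacements are governed by an extremal choice: among the pairs of a matched set \<open>Z\<close> and a
  domain \<open>E\<close> on which the injection is still in use, take one with \<open>Z\<close> as large as possible. Each
  replacement would enlarge \<open>Z\<close>.
\<close>
theorem partial_injection_imp_matching:
  assumes "finite U" "D \<subseteq> U" "\<sigma> ` D \<subseteq> U" and inj: "inj_on \<sigma> D"
    and adj: "\<And>x. x \<in> D \<Longrightarrow> adj x (\<sigma> x)"
    and irrefl: "\<And>x. \<not> adj x x"
    and linked: "\<And>c c'. \<lbrakk>set c \<subseteq> U; set c' \<subseteq> U; odd (length c); odd (length c');
        closed_walk adj c; closed_walk adj c'\<rbrakk> \<Longrightarrow> \<exists>a\<in>set c. \<exists>b\<in>set c'. adj a b"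
  shows "\<exists>Z\<subseteq>U. perfectly_matched adj Z \<and> card D \<le> Suc (card Z)"
proof -
  define P where "P = (\<lambda>(Z, E). perfectly_matched adj Z \<and> Z \<subseteq> U \<and> E \<subseteq> D \<and>
    Z \<inter> (E \<union> \<sigma> ` E) = {} \<and> card D \<le> card Z + card E)"
  have "P ({}, D)"
    by (auto simp: P_def intro: perfectly_matched.empty)
  moreover have "\<forall>p. P p \<longrightarrow> card (fst p) < Suc (card U)"
    using \<open>finite U\<close> by (auto simp: P_def less_Suc_eq_le intro: card_mono)
  ultimately obtain p where "P p" and max: "\<And>q. P q \<Longrightarrow> card (fst q) \<le> card (fst p)"
    using ex_has_greatest_nat[of P "({}, D)" "\<lambda>p. card (fst p)" "Suc (card U)"] by blast
  then obtain Z E where p: "p = (Z, E)" and Z: "perfectly_matched adj Z" "Z \<subseteq> U"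
    and E: "E \<subseteq> D" "Z \<inter> (E \<union> \<sigma> ` E) = {}" "card D \<le> card Z + card E"
    by (cases p) (auto simp: P_def)
  have fin: "finite Z" "finite D" "finite E"
    using Z E \<open>D \<subseteq> U\<close> \<open>finite U\<close> by (meson finite_subset)+
  have injE: "inj_on \<sigma> E"
    using inj E(1) by (rule inj_on_subset)
  \<comment> \<open>Trading part of \<open>E\<close> for a matched set \<open>W\<close> with at least as many vertices contradicts the choice of \<open>Z\<close>.\<close>
  have grow: False
    if "perfectly_matched adj (Z \<union> W)" "Z \<union> W \<subseteq> U" "(Z \<union> W) \<inter> (E' \<union> \<sigma> ` E') = {}"
      "W \<inter> Z = {}" "finite W" "W \<noteq> {}" "E' \<subseteq> E" "card E \<le> card W + card E'" for W E'
  proof -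
    have "card (Z \<union> W) = card Z + card W"
      using fin that by (intro card_Un_disjoint) auto
    moreover from this have "P (Z \<union> W, E')"
      using that E unfolding P_def by auto
    then have "card (Z \<union> W) \<le> card Z"
      using max p by fastforce
    ultimately show False
      using \<open>finite W\<close> \<open>W \<noteq> {}\<close> by simp
  qed
  \<comment> \<open>Otherwise a path component starts at some \<open>x\<close>, and its first edge can be matched: only \<open>x\<close> and \<open>\<sigma> x\<close> leave the domain.\<close>
  have "E \<subseteq> \<sigma> ` E"
  proof (rule ccontr)
    assume "\<not> E \<subseteq> \<sigma> ` E"
    then obtain x where x: "x \<in> E" "x \<notin> \<sigma> ` E" by blast
    let ?W = "{x, \<sigma> x}"
    have "\<sigma> x \<noteq> x"
      using x adj E(1) irrefl by (metis image_eqI)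
    then have "card ?W = 2" by simp
    have *: "x \<notin> Z" "\<sigma> x \<notin> Z" "\<sigma> x \<in> U"
      using E x \<open>\<sigma> ` D \<subseteq> U\<close> by blast+
    then have "perfectly_matched adj (insert x (insert (\<sigma> x) Z))"
      using x \<open>\<sigma> x \<noteq> x\<close> E(1) adj Z(1) by (intro perfectly_matched.insert) auto
    then have 1: "perfectly_matched adj (Z \<union> ?W)"
      by (simp add: insert_commute Un_commute)
    have 2: "card E \<le> card ?W + card (E - ?W)"
      using diff_card_le_card_Diff[of ?W E] by simp
    have "?W \<inter> \<sigma> ` (E - ?W) = {}"
      using x injE by (auto dest: inj_onD)
    then have 3: "(Z \<union> ?W) \<inter> ((E - ?W) \<union> \<sigma> ` (E - ?W)) = {}"
      using E(2) by blast
    have "x \<in> U"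
      using x E(1) \<open>D \<subseteq> U\<close> by blast
    then show False
      using * Z(2) by (intro grow[OF 1 _ 3 _ _ _ _ 2]) auto
  qed
  then have perm: "\<sigma> ` E = E"
    using fin(3) injE by (metis card_image card_subset_eq finite_imageI)
  \<comment> \<open>A union of cycles with a perfect matching could be moved to \<open>Z\<close>; hence the remaining cycles are odd and unlinked, so there is at most one.\<close>
  have no_closed: "W = {}" if "W \<subseteq> E" "\<sigma> ` W = W" "perfectly_matched adj W" for W
  proof (rule ccontr)
    assume "W \<noteq> {}"
    have "\<sigma> ` (E - W) = E - W"
      using perm that injE by (metis inj_on_image_set_diff Diff_subset)
    moreover have "finite W" "card E \<le> card W + card (E - W)"
      using that fin by (auto simp: finite_subset card_Diff_subset)
    moreover have "perfectly_matched adj (Z \<union> W)"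
      using that Z E by (intro perfectly_matched_Un) auto
    ultimately show False
      using \<open>W \<noteq> {}\<close> that Z E \<open>D \<subseteq> U\<close> by (intro grow[of W "E - W"]) auto
  qed
  have orbit: "\<exists>c. x \<in> set c \<and> set c \<subseteq> F \<and> \<sigma> ` set c = set c \<and> distinct c \<and> closed_walk adj c \<and> odd (length c)"
    if F: "F \<subseteq> E" "\<sigma> ` F = F" "x \<in> F" for F x
  proof -
    obtain c where c: "x \<in> set c" "set c \<subseteq> F" "\<sigma> ` set c = set c" "distinct c" "closed_walk adj c"
      using orbit_is_closed_walk[of F \<sigma> x adj] F E(1) adj fin finite_subset by (metis subsetD)
    moreover have "odd (length c)"
      using no_closed[of "set c"] c F even_cycle_perfectly_matched by (metis empty_iff order_trans)
    ultimately show ?thesis by blast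
  qed
  show ?thesis
  proof (cases "E = {}")
    case True
    then show ?thesis using Z E by auto
  next
    case False
    then obtain x where "x \<in> E" by blast
    then obtain c where c: "x \<in> set c" "set c \<subseteq> E" "\<sigma> ` set c = set c" "distinct c"
      "closed_walk adj c" "odd (length c)"
      using orbit[of E] perm by blast
    have "E \<subseteq> set c"
    proof (rule ccontr)
      assume "\<not> E \<subseteq> set c"
      then obtain y where "y \<in> E - set c" by blast
      moreover have "\<sigma> ` (E - set c) = E - set c"
        using perm c injE by (metis inj_on_image_set_diff Diff_subset)
      ultimately obtain c' where c': "y \<in> set c'" "set c' \<subseteq> E - set c" "\<sigma> ` set c' = set c'"
        "distinct c'" "closed_walk adj c'" "odd (length c')"
        using orbit[of "E - set c"] by blast
      then have "set c \<subseteq> U" "set c' \<subseteq> U"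
        using c(2) E(1) \<open>D \<subseteq> U\<close> by auto
      then obtain a b where "a \<in> set c" "b \<in> set c'" "adj a b"
        using linked[OF _ _ c(6) c'(6) c(5) c'(5)] by blast
      then have "perfectly_matched adj (set c \<union> set c')"
        using c c' by (intro linked_odd_cycles_perfectly_matched) auto
      then show False
        using no_closed[of "set c \<union> set c'"] c c' by (auto simp: image_Un)
    qed
    then have "set c = E"
      using c(2) by blast
    then have "perfectly_matched adj (E - {x})"
      using odd_cycle_minus_vertex_perfectly_matched[OF c(5,4,1,6)] by simp
    then have "perfectly_matched adj (Z \<union> (E - {x}))"
      using Z E by (intro perfectly_matched_Un) auto
    moreover have "card (Z \<union> (E - {x})) = card Z + (card E - 1)"
      using fin E \<open>x \<in> E\<close> by (subst card_Un_disjoint) auto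
    then have "card D \<le> Suc (card (Z \<union> (E - {x})))"
      using E(3) by linarith
    ultimately show ?thesis
      using Z E \<open>D \<subseteq> U\<close> by (intro exI[of _ "Z \<union> (E - {x})"]) auto
  qed
qed

section \<open>Induced odd cycles\<close>

text \<open>
  A shortest odd closed walk in the given vertex set is an induced cycle: a repeated vertex or a
  chord splits it into two closed walks whose lengths add up to an odd number, and the odd one of
  them is shorter.
\<close>
lemma odd_closed_walk_contains_induced_odd_cycle:
  assumes "simple_graph E" "odd (length c)" "cycle_edges c \<subseteq> E"
  obtains d where "set d \<subseteq> set c" "odd (length d)" "is_cycle E d" "\<And>e. e \<in> E \<Longrightarrow> \<not> is_chord d e"
proof -
  define P where "P = (\<lambda>d. odd (length d) \<and> cycle_edges d \<subseteq> E \<and> set d \<subseteq> set c)"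
  obtain d where "P d" and min: "\<And>d'. P d' \<Longrightarrow> length d \<le> length d'"
    using ex_has_least_nat[of P c length] assms by (auto simp: P_def)
  define L where "L = length d"
  \<comment> \<open>Reading the walk periodically makes both pieces of a split intervals of indices.\<close>
  define g where "g t = d ! (t mod L)" for t
  have d: "odd L" "cycle_edges d \<subseteq> E" "set d \<subseteq> set c"
    using \<open>P d\<close> by (simp_all add: P_def L_def)
  have "L > 0"
    using d(1) by (rule odd_pos)
  then have g_in: "g t \<in> set d" and g_nth: "i < L \<Longrightarrow> g i = d ! i" and g_add: "g (i + L) = g i" for t i
    by (simp_all add: g_def L_def)
  have edge: "{g t, g (Suc t)} \<in> E" for t
  proof -
    have "{d ! (t mod L), d ! (Suc (t mod L) mod L)} \<in> cycle_edges d"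
      using \<open>L > 0\<close> unfolding cycle_edges_def L_def by (intro CollectI exI[of _ "t mod length d"]) simp
    then show ?thesis
      using d(2) by (auto simp: g_def mod_Suc_eq)
  qed
  \<comment> \<open>A stretch of the walk that is closed by an edge competes with the whole walk.\<close>
  have shorter: "L \<le> b - a" if "a < b" "odd (b - a)" "{g (b - 1), g a} \<in> E" for a b
  proof -
    have "cycle_edges (map g [a..<b]) \<subseteq> E"
    proof
      fix e assume "e \<in> cycle_edges (map g [a..<b])"
      then obtain i where i: "i < b - a" "e = {map g [a..<b] ! i, map g [a..<b] ! (Suc i mod (b - a))}"
        by (auto simp: cycle_edges_def)
      show "e \<in> E"
      proof (cases "Suc i = b - a")
        case True
        then have "a + i = b - 1"
          using \<open>a < b\<close> by simp
        then have "e = {g (b - 1), g a}"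
          using i True by simp
        then show ?thesis using that by simp
      next
        case False
        then show ?thesis using i edge[of "a + i"] by simp
      qed
    qed
    moreover have "set (map g [a..<b]) \<subseteq> set c"
      using g_in d(3) by auto
    ultimately have "P (map g [a..<b])"
      using that(2) by (simp add: P_def)
    then show ?thesis
      using min by (fastforce simp: L_def)
  qed
  have "distinct d"
  proof (rule ccontr)
    assume "\<not> distinct d"
    then obtain i j where ij: "i < j" "j < L" "g i = g j"
      by (auto simp: distinct_conv_nth L_def g_nth) (metis L_def g_nth linorder_neqE_nat)
    show False
    proof (cases "odd (j - i)")
      case True
      then have "L \<le> j - i"
        using ij edge[of "j - 1"] by (intro shorter) auto
      then show False using ij by simp
    next
      case False
      then have "odd (i + L - j)"
        using ij d(1) by presburger
      moreover have "{g (i + L - 1), g j} \<in> E"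
        using edge[of "i + L - 1"] ij \<open>L > 0\<close> g_add[of i] by simp
      ultimately have "L \<le> i + L - j"
        using ij by (intro shorter) auto
      then show False using ij by simp
    qed
  qed
  moreover have "L \<noteq> 1"
    using edge[of 0] assms(1) by (auto simp: g_def simple_graph_def)
  then have "length d \<ge> 3"
    using d(1) unfolding L_def by presburger
  moreover have "\<not> is_chord d e" if "e \<in> E" for e
  proof
    assume chord: "is_chord d e"
    then obtain x y where xy: "e = {x, y}" "x \<noteq> y"
      by (auto simp: is_chord_def card_2_iff)
    then have "x \<in> set d" "y \<in> set d"
      using chord by (auto simp: is_chord_def)
    then obtain i j where ij: "i < j" "j < L" "e = {g i, g j}"
    proof -
      obtain i j where "i < L" "j < L" "x = g i" "y = g j"
        using \<open>x \<in> set d\<close> \<open>y \<in> set d\<close> g_nth unfolding in_set_conv_nth L_def by metis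
      moreover from this have "i < j \<or> j < i"
        using xy(2) by (metis linorder_neqE_nat)
      ultimately show thesis
        using that[of i j] that[of j i] xy(1) by (auto simp: insert_commute)
    qed
    have cycle: "e \<noteq> {g t, g (Suc t)}" for t
    proof
      assume "e = {g t, g (Suc t)}"
      then have "e = {d ! (t mod L), d ! (Suc (t mod L) mod L)}"
        by (simp add: g_def mod_Suc_eq)
      then have "e \<in> cycle_edges d"
        using \<open>L > 0\<close> unfolding cycle_edges_def L_def by (intro CollectI exI[of _ "t mod length d"]) simp
      then show False using chord by (simp add: is_chord_def)
    qed
    show False
    proof (cases "odd (j + 1 - i)")
      case True
      then have "L \<le> j + 1 - i"
        using ij \<open>e \<in> E\<close> by (intro shorter) (auto simp: insert_commute)
      then have "i = 0" "j = L - 1"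
        using ij by simp_all
      then have "e = {g j, g (Suc j)}"
        using ij g_add[of 0] by auto
      then show False using cycle by blast
    next
      case False
      then have "odd (i + L + 1 - j)"
        using ij d(1) by presburger
      then have "L \<le> i + L + 1 - j"
        using ij \<open>e \<in> E\<close> g_add[of i] by (intro shorter) auto
      then have "j = Suc i"
        using ij by simp
      then show False using ij cycle by blast
    qed
  qed
  moreover have "is_cycle E d" if "distinct d" "length d \<ge> 3"
    using that d(2) by (simp add: is_cycle_def)
  ultimately show thesis
    using that d by (simp add: L_def)
qed

section \<open>Matchings with prescribed vertex multiplicities\<close>

definition incidences :: "'v set list \<Rightarrow> 'v \<Rightarrow> nat" where
  "incidences es v = length (filter (\<lambda>e. v \<in> e) es)"

lemma incidences_simps [simp]:
  "incidences [] v = 0"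
  "incidences (e # es) v = of_bool (v \<in> e) + incidences es v"
  "incidences (es @ es') v = incidences es v + incidences es' v"
  by (simp_all add: incidences_def)

lemma sum_incidences: "(\<Sum>v\<in>UNIV. incidences es (v :: 'v::finite)) = sum_list (map card es)"
  by (induction es) (simp_all add: sum.distrib)

lemma sum_incidences_edges:
  assumes "simple_graph E" "set es \<subseteq> E"
  shows "(\<Sum>v\<in>UNIV. incidences es (v :: 'v::finite)) = 2 * length es"
  unfolding sum_incidences using assms(2)
proof (induction es)
  case (Cons e es)
  then have "card e = 2" using assms(1) by (simp add: simple_graph_def)
  with Cons show ?case by simp
qed simp

text \<open>
  In the blow-up of a graph the vertex \<open>v\<close> is replaced by copies \<open>(v, i)\<close>. A matching there projects
  to a multiset of edges that uses \<open>v\<close> as often as copies of \<open>v\<close> are matched.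
\<close>
lemma perfectly_matched_blow_up_imp_edges:
  assumes "simple_graph E" "perfectly_matched (\<lambda>p q. {fst p, fst q} \<in> E) Z"
  shows "\<exists>es. set es \<subseteq> E \<and> 2 * length es = card Z \<and> (\<forall>v. incidences es v = card {p\<in>Z. fst p = v})"
  using assms(2)
proof (induction rule: perfectly_matched.induct)
  case (insert Z x y)
  then obtain es where es: "set es \<subseteq> E" "2 * length es = card Z" "\<And>v. incidences es v = card {p\<in>Z. fst p = v}"
    by blast
  have fin: "finite Z"
    using insert(1) by (rule perfectly_matched_imp_finite)
  have neq: "fst x \<noteq> fst y"
    using insert(2) assms(1) by (force simp: simple_graph_def)
  have "incidences ({fst x, fst y} # es) v = card {p\<in>insert x (insert y Z). fst p = v}" for v
  proof -
    have "{p\<in>insert x (insert y Z). fst p = v}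
        = (if fst x = v then {x} else {}) \<union> (if fst y = v then {y} else {}) \<union> {p\<in>Z. fst p = v}"
      by auto
    then show ?thesis
      using es(3) neq insert(4,5) fin by auto
  qed
  moreover have "2 * length ({fst x, fst y} # es) = card (insert x (insert y Z))"
    using es(2) insert fin by simp
  ultimately show ?case
    using es(1) insert(2) by (intro exI[of _ "{fst x, fst y} # es"]) simp
qed (auto intro: exI[of _ "[]"])

text \<open>
  Without Hochster configurations any two odd closed walks are joined by an edge, even walks that
  are not induced cycles or that meet: otherwise the induced odd cycles inside them would form a
  configuration. The map \<open>f\<close> is the projection of a blow-up to the graph.
\<close>
lemma odd_closed_walks_linked:
  assumes "simple_graph E" and no_config: "\<nexists>c1 c2. hochster_configuration E c1 c2"
    and c: "odd (length c)" "closed_walk (\<lambda>p q. {f p, f q} \<in> E) c"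
    and c': "odd (length c')" "closed_walk (\<lambda>p q. {f p, f q} \<in> E) c'"
  shows "\<exists>p\<in>set c. \<exists>q\<in>set c'. {f p, f q} \<in> E"
proof (rule ccontr)
  assume no_link: "\<not> ?thesis"
  have "\<exists>d. set d \<subseteq> f ` set c \<and> odd (length d) \<and> is_cycle E d \<and> (\<forall>e\<in>E. \<not> is_chord d e)"
    if "odd (length c)" "closed_walk (\<lambda>p q. {f p, f q} \<in> E) c" for c
  proof -
    have "cycle_edges (map f c) \<subseteq> E"
    proof
      fix e assume "e \<in> cycle_edges (map f c)"
      then obtain i where i: "i < length c" "e = {map f c ! i, map f c ! (Suc i mod length c)}"
        by (auto simp: cycle_edges_def)
      then have "Suc i mod length c < length c"
        by (intro mod_less_divisor) auto
      then show "e \<in> E"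
        using i that(2) by (simp add: closed_walk_def)
    qed
    with assms(1) that(1) show ?thesis
      using odd_closed_walk_contains_induced_odd_cycle[of E "map f c"] by (metis length_map set_map)
  qed
  from this[OF c] this[OF c'] obtain d d'
    where d: "set d \<subseteq> f ` set c" "odd (length d)" "is_cycle E d" "\<forall>e\<in>E. \<not> is_chord d e"
      and d': "set d' \<subseteq> f ` set c'" "odd (length d')" "is_cycle E d'" "\<forall>e\<in>E. \<not> is_chord d' e"
    by blast
  have "set d \<inter> neighbours E (set d') = {}"
    using no_link d(1) d'(1) unfolding neighbours_def by (fastforce simp: insert_commute)
  then have "hochster_configuration E d d'"
    using d d' by (simp add: hochster_configuration_def)
  then show False using no_config by blast
qed

text \<open>
  This is the combinatorial core. A function \<open>w\<close> with values in \<open>{0, 1, 2}\<close> and sum at least \<open>2\<close>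
  on each edge is twice a half-integral vertex cover, so the hypothesis says that the fractional
  matching number for the vertex capacities \<open>d\<close> is at least \<open>N\<close>. Konig's theorem for the bipartite
  double cover of the blow-up gives a matching with at least \<open>2N\<close> edges there, which is a partial injection
  of the blow-up. The loss of one vertex in passing to a matching of the blow-up is harmless, since
  the number of matched vertices is even.
\<close>
theorem integral_matching_if_half_integral_covers_large:
  fixes E :: "'v::finite set set" and d :: "'v \<Rightarrow> nat"
  assumes E: "simple_graph E" and no_config: "\<nexists>c1 c2. hochster_configuration E c1 c2"
    and covers: "\<And>w. \<lbrakk>\<And>v. w v \<le> 2; \<And>u v. {u, v} \<in> E \<Longrightarrow> 2 \<le> w u + w v\<rbrakk>
      \<Longrightarrow> 2 * N \<le> (\<Sum>v\<in>UNIV. w v * d v)"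
  shows "\<exists>es. set es \<subseteq> E \<and> length es = N \<and> (\<forall>v. incidences es v \<le> d v)"
proof -
  define U where "U = (SIGMA v:UNIV. {..<d v})"
  define adj where "adj = (\<lambda>(p :: 'v \<times> nat) (q :: 'v \<times> nat). {fst p, fst q} \<in> E)"
  define R where "R = {(p, q). p \<in> U \<and> q \<in> U \<and> adj p q}"
  have "finite U"
    unfolding U_def by (intro finite_SigmaI) simp_all
  then have "finite R"
    using finite_subset[of R "U \<times> U"] by (auto simp: R_def)
  have "2 * N \<le> card X + card Y" if cov: "bipartite_cover R X Y" for X Y
  proof -
    \<comment> \<open>All copies of a vertex have the same neighbours, so only those vertices matter of which the cover contains every copy.\<close>
    define full where "full Z = {v. {v} \<times> {..<d v} \<subseteq> Z}" for Z :: "('v \<times> nat) set"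
    define w where "w v = (of_bool (v \<in> full X) + of_bool (v \<in> full Y) :: nat)" for v
    have card_full: "(\<Sum>v\<in>UNIV. of_bool (v \<in> full Z) * d v) \<le> card Z" if "finite Z" for Z
    proof -
      have "(\<Sum>v\<in>UNIV. of_bool (v \<in> full Z) * d v) = (\<Sum>v\<in>full Z. d v)"
        by (simp add: of_bool_def if_distrib[of "\<lambda>x. x * _"] sum.If_cases cong: if_cong)
      also have "\<dots> = card (SIGMA v:full Z. {..<d v})"
        by (simp add: card_SigmaI)
      also have "\<dots> \<le> card Z"
        using that by (intro card_mono) (auto simp: full_def)
      finally show ?thesis .
    qed
    have half: "u \<in> full X \<or> v \<in> full Y" if "{u, v} \<in> E" for u v
    proof (rule ccontr)
      assume "\<not> ?thesis"
      then obtain i j where "i < d u" "(u, i) \<notin> X" "j < d v" "(v, j) \<notin> Y"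
        by (auto simp: full_def)
      moreover from this have "((u, i), (v, j)) \<in> R"
        using that by (simp add: R_def U_def adj_def)
      ultimately show False
        using cov by (auto simp: bipartite_cover_def)
    qed
    have "2 \<le> w u + w v" if "{u, v} \<in> E" for u v
      using half[of u v] half[of v u] that by (auto simp: w_def insert_commute)
    then have "2 * N \<le> (\<Sum>v\<in>UNIV. w v * d v)"
      by (intro covers) (auto simp: w_def)
    also have "\<dots> \<le> card X + card Y"
      using card_full[of X] card_full[of Y] cov
      by (simp add: w_def add_mult_distrib sum.distrib bipartite_cover_def)
    finally show ?thesis .
  qed
  from konig[OF \<open>finite R\<close> this] obtain M
    where M: "M \<subseteq> R" "inj_on fst M" "inj_on snd M" "2 * N \<le> card M"
    by blast
  define \<sigma> where "\<sigma> p = snd (inv_into M fst p)" for p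
  have \<sigma>: "(p, \<sigma> p) \<in> M" if "p \<in> fst ` M" for p
    using inv_into_into[OF that] f_inv_into_f[OF that] by (metis \<sigma>_def prod.collapse)
  have \<sigma>_edge: "p \<in> U" "\<sigma> p \<in> U" "adj p (\<sigma> p)" if "p \<in> fst ` M" for p
    using \<sigma>[OF that] M(1) unfolding R_def by blast+
  have "\<exists>Z\<subseteq>U. perfectly_matched adj Z \<and> card (fst ` M) \<le> Suc (card Z)"
  proof (rule partial_injection_imp_matching[OF \<open>finite U\<close>])
    show "fst ` M \<subseteq> U" "\<sigma> ` fst ` M \<subseteq> U"
      using \<sigma>_edge(1,2) by blast+
    show "inj_on \<sigma> (fst ` M)"
    proof (rule inj_onI)
      fix p q assume pq: "p \<in> fst ` M" "q \<in> fst ` M" and eq: "\<sigma> p = \<sigma> q"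
      show "p = q"
        using inj_onD[OF M(3) _ \<sigma>[OF pq(1)] \<sigma>[OF pq(2)]] eq by simp
    qed
    show "adj p (\<sigma> p)" if "p \<in> fst ` M" for p
      using \<sigma>_edge(3)[OF that] .
    show "\<not> adj p p" for p
      using E by (auto simp: adj_def simple_graph_def)
    show "\<exists>p\<in>set c. \<exists>q\<in>set c'. adj p q"
      if "odd (length c)" "odd (length c')" "closed_walk adj c" "closed_walk adj c'" for c c'
      using odd_closed_walks_linked[OF E no_config that(1) _ that(2)] that(3,4) by (simp add: adj_def)
  qed
  then obtain Z where Z: "Z \<subseteq> U" "perfectly_matched adj Z" "card M \<le> Suc (card Z)"
    using M(2) by (auto simp: card_image)
  then obtain es where es: "set es \<subseteq> E" "2 * length es = card Z"
    "\<And>v. incidences es v = card {p\<in>Z. fst p = v}"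
    using perfectly_matched_blow_up_imp_edges[OF E] unfolding adj_def by blast
  have inc: "incidences es v \<le> d v" for v
  proof -
    have "card {p\<in>Z. fst p = v} \<le> card ({v} \<times> {..<d v})"
      using Z(1) by (intro card_mono) (auto simp: U_def)
    then show ?thesis by (simp add: es(3) card_cartesian_product)
  qed
  have "N \<le> length es"
    using M(4) Z(3) es(2) by linarith
  moreover have "incidences (take N es) v \<le> d v" for v
    using inc[of v] incidences_simps(3)[of "take N es" "drop N es" v] by simp
  moreover have "set (take N es) \<subseteq> E"
    using es(1) set_take_subset[of N es] by auto
  ultimately show ?thesis
    by (intro exI[of _ "take N es"]) simp
qed

section \<open>Monomial ideals\<close>

text \<open>
  The ideal is described by its monomials, not by generators: the exponents of its elements lie
  above elements of \<open>A\<close>. That it is the ideal generated by these monomials is shown below.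
\<close>
definition monomial_ideal :: "('v \<Rightarrow>\<^sub>0 nat) set \<Rightarrow> ('v, 'k::field) polyring set" where
  "monomial_ideal A = {f. \<forall>b\<in>Poly_Mapping.keys f. \<exists>a\<in>A. \<exists>c. b = a + c}"

lemma poly_mapping_sum_single:
  "(\<Sum>b\<in>Poly_Mapping.keys f. Poly_Mapping.single b (Poly_Mapping.lookup f b)) = f"
proof (rule poly_mapping_eqI)
  fix k
  have "Poly_Mapping.lookup (\<Sum>b\<in>Poly_Mapping.keys f. Poly_Mapping.single b (Poly_Mapping.lookup f b)) k
      = (\<Sum>b\<in>Poly_Mapping.keys f. if b = k then Poly_Mapping.lookup f b else 0)"
    by (simp add: lookup_sum lookup_single when_def)
  also have "\<dots> = Poly_Mapping.lookup f k"
    by (simp add: in_keys_iff)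
  finally show "Poly_Mapping.lookup (\<Sum>b\<in>Poly_Mapping.keys f. Poly_Mapping.single b (Poly_Mapping.lookup f b)) k
      = Poly_Mapping.lookup f k" .
qed

lemma subspace_monomial_ideal: "ideal.subspace (monomial_ideal A :: ('v, 'k::field) polyring set)"
proof (rule ideal.subspaceI)
  fix f g :: "('v, 'k) polyring"
  assume g: "g \<in> monomial_ideal A"
  show "f * g \<in> monomial_ideal A"
    unfolding monomial_ideal_def
  proof (intro CollectI ballI)
    fix k assume "k \<in> Poly_Mapping.keys (f * g)"
    then obtain x y where "k = x + y" "y \<in> Poly_Mapping.keys g"
      using keys_mult[of f g] by blast
    moreover from this(2) obtain a c where "a \<in> A" "y = a + c"
      using g by (auto simp: monomial_ideal_def)
    ultimately have "k = a + (x + c)"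
      by (simp add: add.left_commute)
    then show "\<exists>a\<in>A. \<exists>c. k = a + c"
      using \<open>a \<in> A\<close> by blast
  qed
next
  fix f g :: "('v, 'k) polyring"
  assume fg: "f \<in> monomial_ideal A" "g \<in> monomial_ideal A"
  show "f + g \<in> monomial_ideal A"
    unfolding monomial_ideal_def
  proof (intro CollectI ballI)
    fix k assume "k \<in> Poly_Mapping.keys (f + g)"
    then have "k \<in> Poly_Mapping.keys f \<union> Poly_Mapping.keys g"
      using keys_add[of f g] by (rule subsetD[rotated])
    then show "\<exists>a\<in>A. \<exists>c. k = a + c"
      using fg by (auto simp: monomial_ideal_def)
  qed
qed (simp add: monomial_ideal_def)

lemma single_in_monomial_ideal: "a \<in> A \<Longrightarrow> Poly_Mapping.single a 1 \<in> monomial_ideal A"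
  unfolding monomial_ideal_def by (auto split: if_splits) (metis add_0_right)

lemma monomial_ideal_subset_iff:
  assumes "ideal.subspace J"
  shows "(monomial_ideal A :: ('v, 'k::field) polyring set) \<subseteq> J \<longleftrightarrow> (\<forall>a\<in>A. Poly_Mapping.single a 1 \<in> J)"
proof
  assume "monomial_ideal A \<subseteq> J"
  then show "\<forall>a\<in>A. Poly_Mapping.single a 1 \<in> J"
    using single_in_monomial_ideal by blast
next
  assume J: "\<forall>a\<in>A. Poly_Mapping.single a 1 \<in> J"
  show "monomial_ideal A \<subseteq> J"
  proof
    fix f :: "('v, 'k) polyring" assume f: "f \<in> monomial_ideal A"
    have "(\<Sum>b\<in>Poly_Mapping.keys f. Poly_Mapping.single b (Poly_Mapping.lookup f b)) \<in> J"
    proof (rule ideal.subspace_sum[OF assms])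
      fix b assume "b \<in> Poly_Mapping.keys f"
      then obtain a c where "a \<in> A" "b = a + c"
        using f by (auto simp: monomial_ideal_def)
      then have "Poly_Mapping.single b (Poly_Mapping.lookup f b)
          = Poly_Mapping.single c (Poly_Mapping.lookup f b) * Poly_Mapping.single a 1"
        by (simp add: mult_single add.commute)
      then show "Poly_Mapping.single b (Poly_Mapping.lookup f b) \<in> J"
        using J \<open>a \<in> A\<close> ideal.subspace_scale[OF assms] by metis
    qed
    then show "f \<in> J" by (simp add: poly_mapping_sum_single)
  qed
qed

lemma ideal_generated_monomials:
  "ideal_generated ((\<lambda>a. Poly_Mapping.single a 1) ` A) = (monomial_ideal A :: ('v, 'k::field) polyring set)"
proof (rule subset_antisym)
  show "ideal_generated ((\<lambda>a. Poly_Mapping.single a 1) ` A) \<subseteq> (monomial_ideal A :: ('v, 'k) polyring set)"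
    by (rule ideal.span_minimal[OF _ subspace_monomial_ideal])
      (auto intro: single_in_monomial_ideal)
  show "(monomial_ideal A :: ('v, 'k) polyring set) \<subseteq> ideal_generated ((\<lambda>a. Poly_Mapping.single a 1) ` A)"
    by (auto simp: monomial_ideal_subset_iff[OF ideal.subspace_span] intro: ideal.span_base)
qed

definition sums_of :: "'a::monoid_add set \<Rightarrow> nat \<Rightarrow> 'a set" where
  "sums_of A n = {sum_list as | as. set as \<subseteq> A \<and> length as = n}"

lemma sums_of_0 [simp]: "sums_of A 0 = {0}"
  by (auto simp: sums_of_def)

lemma sums_of_Suc: "sums_of A (Suc n) = {a + b | a b. a \<in> A \<and> b \<in> sums_of A n}"
proof (intro subset_antisym subsetI)
  fix x assume "x \<in> sums_of A (Suc n)"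
  then obtain as where "set as \<subseteq> A" "length as = Suc n" "x = sum_list as"
    by (auto simp: sums_of_def)
  then obtain a as' where "as = a # as'" "a \<in> A" "set as' \<subseteq> A" "length as' = n" "x = a + sum_list as'"
    by (cases as) auto
  then show "x \<in> {a + b | a b. a \<in> A \<and> b \<in> sums_of A n}"
    unfolding sums_of_def by blast
next
  fix x assume "x \<in> {a + b | a b. a \<in> A \<and> b \<in> sums_of A n}"
  then obtain a as where "a \<in> A" "set as \<subseteq> A" "length as = n" "x = a + sum_list as"
    unfolding sums_of_def by blast
  then have "set (a # as) \<subseteq> A" "length (a # as) = Suc n" "x = sum_list (a # as)"
    by auto
  then show "x \<in> sums_of A (Suc n)"
    unfolding sums_of_def by blast
qed

lemma sums_of_add: "a \<in> sums_of A (m + n) \<Longrightarrow> \<exists>b\<in>sums_of A m. \<exists>c\<in>sums_of A n. a = b + c"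
proof -
  assume "a \<in> sums_of A (m + n)"
  then obtain as where as: "set as \<subseteq> A" "length as = m + n" "a = sum_list as"
    by (auto simp: sums_of_def)
  then have "a = sum_list (take m as) + sum_list (drop m as)"
    by (metis append_take_drop_id sum_list_append)
  moreover have "set (take m as) \<subseteq> A" "set (drop m as) \<subseteq> A"
    using as(1) set_take_subset[of m as] set_drop_subset[of m as] by auto
  then have "sum_list (take m as) \<in> sums_of A m" "sum_list (drop m as) \<in> sums_of A n"
    unfolding sums_of_def using as(2) by fastforce+
  ultimately show ?thesis by blast
qed

lemma ideal_generated_mult_monomial_ideals:
  "ideal_generated {f * g | f g. f \<in> (monomial_ideal A :: ('v, 'k::field) polyring set) \<and> g \<in> monomial_ideal B}
    = monomial_ideal {a + b | a b. a \<in> A \<and> b \<in> B}" (is "ideal_generated ?P = monomial_ideal ?S")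
proof (rule subset_antisym)
  have "f * g \<in> monomial_ideal ?S"
    if fg: "f \<in> monomial_ideal A" "g \<in> monomial_ideal B" for f g :: "('v, 'k) polyring"
    unfolding monomial_ideal_def
  proof (intro CollectI ballI)
    fix k assume "k \<in> Poly_Mapping.keys (f * g)"
    then obtain x y where "k = x + y" "x \<in> Poly_Mapping.keys f" "y \<in> Poly_Mapping.keys g"
      using keys_mult[of f g] by blast
    moreover obtain a c where "a \<in> A" "x = a + c"
      using fg(1) \<open>x \<in> Poly_Mapping.keys f\<close> by (auto simp: monomial_ideal_def)
    moreover obtain b d where "b \<in> B" "y = b + d"
      using fg(2) \<open>y \<in> Poly_Mapping.keys g\<close> by (auto simp: monomial_ideal_def)
    ultimately show "\<exists>a\<in>?S. \<exists>c. k = a + c"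
      by (intro bexI[of _ "a + b"] exI[of _ "c + d"]) (auto simp: algebra_simps)
  qed
  then show "ideal_generated ?P \<subseteq> monomial_ideal ?S"
    by (intro ideal.span_minimal[OF _ subspace_monomial_ideal]) blast
  show "monomial_ideal ?S \<subseteq> ideal_generated ?P"
    unfolding monomial_ideal_subset_iff[OF ideal.subspace_span]
  proof
    fix s assume "s \<in> ?S"
    then obtain a b where s: "s = a + b" "a \<in> A" "b \<in> B" by blast
    have "Poly_Mapping.single s (1::'k) = Poly_Mapping.single a 1 * Poly_Mapping.single b 1"
      by (simp add: mult_single s(1))
    then have "Poly_Mapping.single s 1 \<in> ?P"
      using single_in_monomial_ideal[OF s(2)] single_in_monomial_ideal[OF s(3)] by blast
    then show "Poly_Mapping.single s 1 \<in> ideal_generated ?P"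
      by (rule ideal.span_base)
  qed
qed

lemma ideal_power_monomial_ideal:
  "ideal_power (monomial_ideal A :: ('v, 'k::field) polyring set) n = monomial_ideal (sums_of A n)"
proof (induction n)
  case 0
  show ?case by (auto simp: monomial_ideal_def)
next
  case (Suc n)
  then show ?case
    by (simp add: ideal_generated_mult_monomial_ideals sums_of_Suc)
qed

section \<open>Integral closure and weights\<close>

definition weight :: "('v::finite \<Rightarrow> nat) \<Rightarrow> ('v \<Rightarrow>\<^sub>0 nat) \<Rightarrow> nat" where
  "weight w a = (\<Sum>v\<in>UNIV. w v * Poly_Mapping.lookup a v)"

lemma weight_0 [simp]: "weight w 0 = 0"
  by (simp add: weight_def)

lemma weight_add: "weight w (a + b) = weight w a + weight w b"
  by (simp add: weight_def lookup_add algebra_simps sum.distrib)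

lemma weight_sums_of:
  assumes "\<And>a. a \<in> A \<Longrightarrow> N \<le> weight w a" "a \<in> sums_of A n"
  shows "n * N \<le> weight w a"
  using assms(2)
proof (induction n arbitrary: a)
  case (Suc n)
  then obtain b c where "a = b + c" "b \<in> A" "c \<in> sums_of A n"
    by (auto simp: sums_of_Suc)
  with Suc.IH[of c] assms(1)[of b] show ?case
    by (simp add: weight_add add_mono)
qed simp

text \<open>
  A lexicographic comparison of the exponents, with the weight as the first entry, is a monomial
  order. The exponents are encoded as exponents over \<open>nat\<close>, on which the lexicographic order is
  a linear order compatible with addition.
\<close>
lemma exists_monomial_order_refining_weight:
  fixes w :: "'v::finite \<Rightarrow> nat"
  shows "\<exists>\<phi> :: ('v \<Rightarrow>\<^sub>0 nat) \<Rightarrow> (nat \<Rightarrow>\<^sub>0 nat).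
    inj \<phi> \<and> (\<forall>a b. \<phi> (a + b) = \<phi> a + \<phi> b) \<and> (\<forall>a b. \<phi> a \<le> \<phi> b \<longrightarrow> weight w a \<le> weight w b)"
proof -
  obtain idx :: "'v \<Rightarrow> nat" where idx: "inj idx"
    using finite_imp_inj_to_nat_seg[OF finite_UNIV] by blast
  define \<phi> :: "('v \<Rightarrow>\<^sub>0 nat) \<Rightarrow> (nat \<Rightarrow>\<^sub>0 nat)" where
    "\<phi> = (\<lambda>a. Poly_Mapping.single 0 (weight w a)
      + (\<Sum>v\<in>UNIV. Poly_Mapping.single (Suc (idx v)) (Poly_Mapping.lookup a v)))"
  have weight: "Poly_Mapping.lookup (\<phi> a) 0 = weight w a" for a
    by (simp add: \<phi>_def lookup_add lookup_sum lookup_single)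
  have exponent: "Poly_Mapping.lookup (\<phi> a) (Suc (idx v)) = Poly_Mapping.lookup a v" for a v
    using idx by (simp add: \<phi>_def lookup_add lookup_sum lookup_single when_def inj_eq)
  have "inj \<phi>"
    by (rule injI, rule poly_mapping_eqI) (metis exponent)
  moreover have "\<phi> (a + b) = \<phi> a + \<phi> b" for a b
    by (simp add: \<phi>_def weight_add single_add lookup_add sum.distrib algebra_simps)
  moreover have "weight w a \<le> weight w b" if "\<phi> a \<le> \<phi> b" for a b
  proof -
    have "less_fun (Poly_Mapping.lookup (\<phi> a)) (Poly_Mapping.lookup (\<phi> b)) \<or> \<phi> a = \<phi> b"
      using that by transfer auto
    then have "Poly_Mapping.lookup (\<phi> a) 0 \<le> Poly_Mapping.lookup (\<phi> b) 0"
      unfolding less_fun_def by (metis le_eq_less_or_eq not_gr_zero)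
    then show ?thesis by (simp add: weight)
  qed
  ultimately show ?thesis by blast
qed

text \<open>
  The product of the two least terms cannot be cancelled by other products, because \<open>\<phi>\<close> takes
  a strictly larger value on these.
\<close>
lemma lookup_mult_least_exponents:
  fixes \<phi> :: "('v \<Rightarrow>\<^sub>0 nat) \<Rightarrow> 'o::linordered_cancel_ab_semigroup_add"
    and f g :: "('v, 'k::field) polyring"
  assumes "inj \<phi>" and \<phi>_add: "\<And>a b. \<phi> (a + b) = \<phi> a + \<phi> b"
    and f: "\<And>k. k \<in> Poly_Mapping.keys f \<Longrightarrow> \<phi> e \<le> \<phi> k"
    and g: "\<And>k. k \<in> Poly_Mapping.keys g \<Longrightarrow> \<phi> e' \<le> \<phi> k"
  shows "Poly_Mapping.lookup (f * g) (e + e') = Poly_Mapping.lookup f e * Poly_Mapping.lookup g e'"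
proof -
  define f' where "f' = f - Poly_Mapping.single e (Poly_Mapping.lookup f e)"
  define g' where "g' = g - Poly_Mapping.single e' (Poly_Mapping.lookup g e')"
  have keys: "Poly_Mapping.keys f' = Poly_Mapping.keys f - {e}" "Poly_Mapping.keys g' = Poly_Mapping.keys g - {e'}"
    by (auto simp: f'_def g'_def in_keys_iff lookup_minus lookup_single when_def split: if_splits)
  have "e + e' \<notin> Poly_Mapping.keys (f' * g)"
  proof
    assume "e + e' \<in> Poly_Mapping.keys (f' * g)"
    then obtain a b where ab: "e + e' = a + b" "a \<in> Poly_Mapping.keys f'" "b \<in> Poly_Mapping.keys g"
      using keys_mult[of f' g] by blast
    then have "\<phi> e \<le> \<phi> a" "\<phi> e \<noteq> \<phi> a" "\<phi> e' \<le> \<phi> b"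
      using f g keys \<open>inj \<phi>\<close> by (auto dest: injD)
    then have "\<phi> (e + e') < \<phi> (a + b)"
      unfolding \<phi>_add by (intro add_less_le_mono) auto
    then show False using ab(1) by simp
  qed
  moreover have "e + e' \<notin> Poly_Mapping.keys (Poly_Mapping.single e (Poly_Mapping.lookup f e) * g')"
    using keys_mult[of "Poly_Mapping.single e (Poly_Mapping.lookup f e)" g'] keys
    by (auto split: if_splits)
  moreover have "f * g = Poly_Mapping.single (e + e') (Poly_Mapping.lookup f e * Poly_Mapping.lookup g e')
      + Poly_Mapping.single e (Poly_Mapping.lookup f e) * g' + f' * g"
    by (simp add: mult_single[symmetric] f'_def g'_def algebra_simps)
  ultimately show ?thesis
    by (simp add: lookup_add in_keys_iff)
qed

lemma lookup_power_least_exponent: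
  fixes \<phi> :: "('v \<Rightarrow>\<^sub>0 nat) \<Rightarrow> 'o::linordered_cancel_ab_semigroup_add"
    and f :: "('v, 'k::field) polyring"
  assumes "inj \<phi>" and \<phi>_add: "\<And>a b. \<phi> (a + b) = \<phi> a + \<phi> b"
    and f: "\<And>k. k \<in> Poly_Mapping.keys f \<Longrightarrow> \<phi> e \<le> \<phi> k"
  shows "Poly_Mapping.lookup (f ^ m) (sum_list (replicate m e)) = Poly_Mapping.lookup f e ^ m"
proof -
  have "Poly_Mapping.lookup (f ^ m) (sum_list (replicate m e)) = Poly_Mapping.lookup f e ^ m
    \<and> (\<forall>k\<in>Poly_Mapping.keys (f ^ m). \<phi> (sum_list (replicate m e)) \<le> \<phi> k)"
  proof (induction m)
    case (Suc m)
    then have "\<forall>k\<in>Poly_Mapping.keys (f * f ^ m). \<phi> (e + sum_list (replicate m e)) \<le> \<phi> k"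
      using keys_mult[of f "f ^ m"] f by (fastforce simp: \<phi>_add intro: add_mono)
    then show ?case
      using Suc lookup_mult_least_exponents[OF assms(1) \<phi>_add f, where g = "f ^ m" and e' = "sum_list (replicate m e)"] by simp
  qed (simp add: lookup_one)
  then show ?thesis by blast
qed

lemma keys_power_weight:
  assumes "\<And>k. k \<in> Poly_Mapping.keys f \<Longrightarrow> D \<le> weight w k" "k \<in> Poly_Mapping.keys (f ^ m)"
  shows "m * D \<le> weight w k"
  using assms(2)
proof (induction m arbitrary: k)
  case (Suc m)
  then obtain a b where "k = a + b" "a \<in> Poly_Mapping.keys f" "b \<in> Poly_Mapping.keys (f ^ m)"
    using keys_mult[of f "f ^ m"] by auto
  then show ?case using Suc.IH assms(1) by (simp add: weight_add add_mono)
qed simp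

text \<open>
  A weight function extends to a valuation of the polynomial ring, the least weight of an exponent.
  If \<open>f\<close> had an exponent of weight less than \<open>N\<close>, let \<open>e\<close> be its least exponent for an order that
  refines the weight. In an integral equation of degree \<open>m\<close> the term \<open>f ^ m\<close> has a nonzero coefficient
  at \<open>m e\<close>, while all the other terms contain only exponents of larger weight.
\<close>
theorem weight_bound_integral_closure:
  fixes f :: "('v::finite, 'k::field) polyring"
  assumes "f \<in> integral_closure (monomial_ideal B)"
    and B: "\<And>a. a \<in> B \<Longrightarrow> N \<le> weight w a"
    and b: "b \<in> Poly_Mapping.keys f"
  shows "N \<le> weight w b"
proof -
  obtain \<phi> :: "('v \<Rightarrow>\<^sub>0 nat) \<Rightarrow> (nat \<Rightarrow>\<^sub>0 nat)"
    where \<phi>: "inj \<phi>" "\<And>a b. \<phi> (a + b) = \<phi> a + \<phi> b"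
      and \<phi>_weight: "\<And>a b. \<phi> a \<le> \<phi> b \<Longrightarrow> weight w a \<le> weight w b"
    using exists_monomial_order_refining_weight[of w] by blast
  define e where "e = arg_min_on \<phi> (Poly_Mapping.keys f)"
  have e: "e \<in> Poly_Mapping.keys f" "\<And>k. k \<in> Poly_Mapping.keys f \<Longrightarrow> \<phi> e \<le> \<phi> k"
    using b unfolding e_def by (metis arg_min_if_finite(1) finite_keys empty_iff, metis arg_min_least finite_keys empty_iff)
  obtain m a where m: "m \<ge> 1" and a: "\<And>i. i \<in> {1..m} \<Longrightarrow> a i \<in> ideal_power (monomial_ideal B) i"
    and eq: "f ^ m + (\<Sum>i=1..m. a i * f ^ (m - i)) = 0"
    using assms(1) unfolding integral_closure_def by blast
  let ?me = "sum_list (replicate m e)"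
  have weight_me: "weight w ?me = m * weight w e"
    by (induction m) (simp_all add: weight_add)
  have "N \<le> weight w e"
  proof (rule ccontr)
    assume less: "\<not> N \<le> weight w e"
    have "Poly_Mapping.lookup (a i * f ^ (m - i)) ?me = 0" if i: "i \<in> {1..m}" for i
    proof (rule ccontr)
      assume "Poly_Mapping.lookup (a i * f ^ (m - i)) ?me \<noteq> 0"
      then obtain x y where xy: "?me = x + y" "x \<in> Poly_Mapping.keys (a i)" "y \<in> Poly_Mapping.keys (f ^ (m - i))"
        using keys_mult[of "a i" "f ^ (m - i)"] by (auto simp: in_keys_iff)
      obtain x' c where "x = x' + c" "x' \<in> sums_of B i"
        using a[OF i] xy(2) unfolding ideal_power_monomial_ideal by (auto simp: monomial_ideal_def)
      then have "i * N \<le> weight w x"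
        using weight_sums_of[OF B] by (auto simp: weight_add intro: trans_le_add1)
      moreover have "i * weight w e < i * N"
        using i less by simp
      moreover have "(m - i) * weight w e \<le> weight w y"
        using xy(3) e \<phi>_weight by (intro keys_power_weight) auto
      moreover have "m * weight w e = i * weight w e + (m - i) * weight w e"
        using i by (simp flip: add_mult_distrib)
      moreover have "weight w x + weight w y = m * weight w e"
        using weight_me xy(1) weight_add by metis
      ultimately show False by linarith
    qed
    moreover have "Poly_Mapping.lookup (f ^ m) ?me = Poly_Mapping.lookup f e ^ m"
      using \<phi> e by (intro lookup_power_least_exponent) auto
    moreover have "Poly_Mapping.lookup (f ^ m) ?me
        + (\<Sum>i=1..m. Poly_Mapping.lookup (a i * f ^ (m - i)) ?me) = 0"
      using arg_cong[OF eq, of "\<lambda>p. Poly_Mapping.lookup p ?me"] by (simp add: lookup_add lookup_sum)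
    ultimately show False
      using e(1) by (simp add: in_keys_iff)
  qed
  also have "\<dots> \<le> weight w b"
    using e b \<phi>_weight by blast
  finally show ?thesis .
qed

lemma subset_integral_closure: "J \<subseteq> integral_closure J"
proof
  fix x assume "x \<in> J"
  then have "x * (- 1) \<in> ideal_generated {a * b | a b. a \<in> J \<and> b \<in> UNIV}"
    by (intro ideal.span_base) blast
  then show "x \<in> integral_closure J"
    unfolding integral_closure_def by (auto intro!: exI[of _ 1] exI[of _ "\<lambda>_. - x"])
qed

text \<open>
  Every weight bounds the exponents in the integral closure, so it suffices to treat those exponents
  that satisfy all these linear inequalities. This replaces the convex hull of the Newton polyhedron
  by the inequalities that describe it.
\<close>
lemma normal_monomial_idealI:
  assumes "\<And>n b. \<lbrakk>n \<ge> 1; \<And>w N. (\<And>a. a \<in> A \<Longrightarrow> N \<le> weight w a) \<Longrightarrow> n * N \<le> weight w b\<rbrakk>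
    \<Longrightarrow> \<exists>a\<in>sums_of A n. \<exists>c. b = a + c"
  shows "normal_ideal (monomial_ideal A :: ('v::finite, 'k::field) polyring set)"
  unfolding normal_ideal_def ideal_power_monomial_ideal
proof (intro allI impI subset_antisym subset_integral_closure subsetI)
  fix n :: nat and f :: "('v, 'k) polyring"
  assume "n \<ge> 1" and f: "f \<in> integral_closure (monomial_ideal (sums_of A n))"
  show "f \<in> monomial_ideal (sums_of A n)"
    unfolding monomial_ideal_def
    using assms[OF \<open>n \<ge> 1\<close>] weight_bound_integral_closure[OF f] weight_sums_of by blast
qed

text \<open>
  A monomial whose square lies in the square of an ideal is integral over the ideal; the witness
  is the equation \<open>x\<^sup>2 - x\<^sup>2 = 0\<close>, with coefficient \<open>0\<close> in degree one.
\<close>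
lemma not_normal_monomial_idealI:
  assumes "n \<ge> 1" "b + b \<in> sums_of A (n + n)" "\<And>a c. a \<in> sums_of A n \<Longrightarrow> b \<noteq> a + c"
  shows "\<not> normal_ideal (monomial_ideal A :: ('v, 'k::field) polyring set)"
proof
  let ?J = "monomial_ideal (sums_of A n) :: ('v, 'k) polyring set"
  let ?x = "Poly_Mapping.single b 1 :: ('v, 'k) polyring"
  assume "normal_ideal (monomial_ideal A :: ('v, 'k::field) polyring set)"
  then have "integral_closure ?J = ?J"
    using assms(1) by (auto simp: normal_ideal_def ideal_power_monomial_ideal)
  moreover have "?x \<notin> ?J"
    using assms(3) by (auto simp: monomial_ideal_def)
  moreover have "?x \<in> integral_closure ?J"
  proof -
    obtain a a' where "a \<in> sums_of A n" "a' \<in> sums_of A n" "b + b = a + a'"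
      using sums_of_add[OF assms(2)] by blast
    then have "b + b \<in> sums_of (sums_of A n) 2"
      by (auto simp: numeral_2_eq_2 sums_of_Suc)
    then have "- (?x ^ 2) \<in> ideal_power ?J 2"
      unfolding ideal_power_monomial_ideal
      by (auto simp: monomial_ideal_def power2_eq_square mult_single simp flip: single_uminus
          intro!: bexI[of _ "b + b"] exI[of _ 0])
    moreover have "0 \<in> ideal_power ?J 1"
      unfolding ideal_power_monomial_ideal by (simp add: monomial_ideal_def)
    moreover have "{1..2::nat} = {1, 2}" by auto
    ultimately show ?thesis
      unfolding integral_closure_def
      by (intro CollectI exI[of _ 2] conjI exI[of _ "\<lambda>i. if i = 1 then 0 else - (?x ^ 2)"]) auto
  qed
  ultimately show False by blast
qed

section \<open>Square-free monomials\<close>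

definition indicator_exponent :: "'v::finite set \<Rightarrow> 'v \<Rightarrow>\<^sub>0 nat" where
  "indicator_exponent S = Abs_poly_mapping (\<lambda>v. of_bool (v \<in> S))"

lemma lookup_indicator_exponent [simp]:
  "Poly_Mapping.lookup (indicator_exponent S) v = of_bool (v \<in> S)"
  by (simp add: indicator_exponent_def)

lemma prod_var: "(\<Prod>v\<in>S. var v) = (Poly_Mapping.single (indicator_exponent S) 1 :: ('v::finite, 'k::field) polyring)"
proof (induction S rule: infinite_finite_induct)
  case empty
  have "indicator_exponent {} = (0 :: 'v \<Rightarrow>\<^sub>0 nat)"
    by (rule poly_mapping_eqI) simp
  then show ?case by simp
next
  case (insert x S)
  have "indicator_exponent (insert x S) = Poly_Mapping.single x 1 + indicator_exponent S"
    using insert.hyps by (intro poly_mapping_eqI) (auto simp: lookup_add lookup_single when_def)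
  with insert show ?case
    by (simp add: var_def mult_single)
qed simp

lemma edge_ideal_eq_monomial_ideal: "edge_ideal E = monomial_ideal (indicator_exponent ` E)"
proof -
  have "{\<Prod>v\<in>e. var v | e. e \<in> E}
      = (\<lambda>a. Poly_Mapping.single a 1 :: ('a, 'b) polyring) ` indicator_exponent ` E"
    unfolding prod_var by blast
  then show ?thesis
    by (simp only: edge_ideal_def ideal_generated_monomials)
qed

lemma cover_ideal_eq_monomial_ideal:
  "cover_ideal E = monomial_ideal (indicator_exponent ` {C. minimal_vertex_cover E C})"
proof -
  have "{\<Prod>v\<in>C. var v | C. minimal_vertex_cover E C}
      = (\<lambda>a. Poly_Mapping.single a 1 :: ('a, 'b) polyring) ` indicator_exponent ` {C. minimal_vertex_cover E C}"
    unfolding prod_var by blast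
  then show ?thesis
    by (simp only: cover_ideal_def ideal_generated_monomials)
qed

lemma weight_indicator_exponent: "weight w (indicator_exponent S) = sum w S"
  by (simp add: weight_def sum.inter_restrict[symmetric] of_bool_def if_distrib[of "\<lambda>x. _ * x"] cong: if_cong)

lemma lookup_sum_indicator_exponents:
  "Poly_Mapping.lookup (sum_list (map indicator_exponent es)) v = incidences es v"
  by (induction es) (simp_all add: lookup_add)

lemma sums_of_image: "sums_of (f ` A) n = {sum_list (map f xs) | xs. set xs \<subseteq> A \<and> length xs = n}"
proof (intro subset_antisym subsetI)
  fix y assume "y \<in> sums_of (f ` A) n"
  then obtain ys where ys: "set ys \<subseteq> f ` A" "length ys = n" "y = sum_list ys"
    by (auto simp: sums_of_def)
  then have "\<forall>y\<in>set ys. \<exists>x\<in>A. y = f x" by blast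
  then obtain g where g: "\<And>y. y \<in> set ys \<Longrightarrow> g y \<in> A \<and> y = f (g y)"
    by metis
  then have "ys = map f (map g ys)"
    by (simp add: map_idI)
  moreover have "set (map g ys) \<subseteq> A" using g by auto
  ultimately show "y \<in> {sum_list (map f xs) | xs. set xs \<subseteq> A \<and> length xs = n}"
    using ys by (smt (verit) length_map mem_Collect_eq)
next
  fix y assume "y \<in> {sum_list (map f xs) | xs. set xs \<subseteq> A \<and> length xs = n}"
  then obtain xs where xs: "set xs \<subseteq> A" "length xs = n" "y = sum_list (map f xs)"
    by blast
  then have "set (map f xs) \<subseteq> f ` A" "length (map f xs) = n"
    by auto
  then show "y \<in> sums_of (f ` A) n"
    unfolding sums_of_def xs(3) by blast
qed

lemma ex_add_iff:
  fixes a b :: "'v \<Rightarrow>\<^sub>0 nat"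
  shows "(\<exists>c. b = a + c) \<longleftrightarrow> (\<forall>v. Poly_Mapping.lookup a v \<le> Poly_Mapping.lookup b v)"
proof
  assume le: "\<forall>v. Poly_Mapping.lookup a v \<le> Poly_Mapping.lookup b v"
  have "b = a + (b - a)"
    using le by (intro poly_mapping_eqI) (simp add: lookup_add minus_poly_mapping.rep_eq)
  then show "\<exists>c. b = a + c" by blast
qed (auto simp: lookup_add)

text \<open>
  For ideals generated by square-free monomials, both criteria become statements about lists of
  sets and the number of times they contain each vertex.
\<close>
lemma squarefree_ideal_normalI:
  assumes "\<And>n b. \<lbrakk>n \<ge> 1; \<And>(w :: 'v \<Rightarrow> nat) N. (\<And>S. S \<in> \<S> \<Longrightarrow> N \<le> sum w S) \<Longrightarrow> n * N \<le> (\<Sum>v\<in>UNIV. w v * b v)\<rbrakk>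
    \<Longrightarrow> \<exists>Ss. set Ss \<subseteq> \<S> \<and> length Ss = n \<and> (\<forall>v. incidences Ss v \<le> b v)"
  shows "normal_ideal (monomial_ideal (indicator_exponent ` \<S>) :: ('v::finite, 'k::field) polyring set)"
proof (rule normal_monomial_idealI)
  fix n :: nat and b :: "'v \<Rightarrow>\<^sub>0 nat"
  assume "n \<ge> 1"
    and b: "\<And>w N. (\<And>a. a \<in> indicator_exponent ` \<S> \<Longrightarrow> N \<le> weight w a) \<Longrightarrow> n * N \<le> weight w b"
  have "\<exists>Ss. set Ss \<subseteq> \<S> \<and> length Ss = n \<and> (\<forall>v. incidences Ss v \<le> Poly_Mapping.lookup b v)"
    using \<open>n \<ge> 1\<close>
  proof (rule assms)
    fix w :: "'v \<Rightarrow> nat" and N assume N: "\<And>S. S \<in> \<S> \<Longrightarrow> N \<le> sum w S"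
    have "n * N \<le> weight w b"
    proof (rule b)
      fix a assume "a \<in> indicator_exponent ` \<S>"
      then show "N \<le> weight w a"
        using N by (auto simp: weight_indicator_exponent)
    qed
    then show "n * N \<le> (\<Sum>v\<in>UNIV. w v * Poly_Mapping.lookup b v)"
      by (simp add: weight_def)
  qed
  then obtain Ss where Ss: "set Ss \<subseteq> \<S>" "length Ss = n" "\<And>v. incidences Ss v \<le> Poly_Mapping.lookup b v"
    by blast
  show "\<exists>a\<in>sums_of (indicator_exponent ` \<S>) n. \<exists>c. b = a + c"
  proof (rule bexI[of _ "sum_list (map indicator_exponent Ss)"])
    show "\<exists>c. b = sum_list (map indicator_exponent Ss) + c"
      unfolding ex_add_iff lookup_sum_indicator_exponents using Ss(3) by blast
    show "sum_list (map indicator_exponent Ss) \<in> sums_of (indicator_exponent ` \<S>) n"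
      unfolding sums_of_image using Ss(1,2) by blast
  qed
qed

lemma squarefree_ideal_not_normalI:
  fixes b :: "'v::finite \<Rightarrow> nat"
  assumes "n \<ge> 1" and Ss: "set Ss \<subseteq> \<S>" "length Ss = 2 * n" "\<And>v. incidences Ss v = 2 * b v"
    and not_in: "\<And>Ts. \<lbrakk>set Ts \<subseteq> \<S>; length Ts = n\<rbrakk> \<Longrightarrow> \<exists>v. b v < incidences Ts v"
  shows "\<not> normal_ideal (monomial_ideal (indicator_exponent ` \<S>) :: ('v, 'k::field) polyring set)"
proof (rule not_normal_monomial_idealI[where b = "Abs_poly_mapping b", OF \<open>n \<ge> 1\<close>])
  have "Abs_poly_mapping b + Abs_poly_mapping b = sum_list (map indicator_exponent Ss)"
    by (rule poly_mapping_eqI) (simp add: lookup_add lookup_sum_indicator_exponents Ss(3))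
  then show "Abs_poly_mapping b + Abs_poly_mapping b \<in> sums_of (indicator_exponent ` \<S>) (n + n)"
    unfolding sums_of_image using Ss(1,2) by (intro CollectI exI[of _ Ss]) simp
next
  fix a c :: "'v \<Rightarrow>\<^sub>0 nat" assume "a \<in> sums_of (indicator_exponent ` \<S>) n"
  then obtain Ts where Ts: "set Ts \<subseteq> \<S>" "length Ts = n" "a = sum_list (map indicator_exponent Ts)"
    unfolding sums_of_image by blast
  obtain v where "b v < incidences Ts v"
    using not_in[OF Ts(1,2)] by blast
  show "Abs_poly_mapping b \<noteq> a + c"
  proof
    assume "Abs_poly_mapping b = a + c"
    from arg_cong[OF this, of "\<lambda>p. Poly_Mapping.lookup p v"] \<open>b v < incidences Ts v\<close> show False
      by (simp add: lookup_add Ts(3) lookup_sum_indicator_exponents)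
  qed
qed

section \<open>Hochster configurations\<close>

text \<open>
  A common vertex would be adjacent to its successor on the second cycle.
\<close>
lemma hochster_configuration_disjoint:
  assumes "hochster_configuration E c1 c2"
  shows "set c1 \<inter> set c2 = {}"
proof (rule ccontr)
  assume "set c1 \<inter> set c2 \<noteq> {}"
  then obtain v where "v \<in> set c1" "v \<in> set c2" by blast
  then obtain i where i: "i < length c2" "c2 ! i \<in> set c1"
    by (metis in_set_conv_nth)
  then have "Suc i mod length c2 < length c2"
    by (intro mod_less_divisor) auto
  then have "c2 ! (Suc i mod length c2) \<in> set c2" by simp
  moreover have "{c2 ! (Suc i mod length c2), c2 ! i} \<in> E"
    using assms i(1) unfolding hochster_configuration_def is_cycle_def cycle_edges_def
    by (subst insert_commute) blast
  ultimately have "c2 ! i \<in> neighbours E (set c2)"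
    by (auto simp: neighbours_def)
  then show False
    using assms i(2) by (auto simp: hochster_configuration_def)
qed

lemma card_Union_le_twice_length:
  assumes "\<And>q. q \<in> set qs \<Longrightarrow> card q \<le> 2"
  shows "card (\<Union> (set qs)) \<le> 2 * length qs"
  using assms
proof (induction qs)
  case (Cons q qs)
  have "card (q \<union> \<Union> (set qs)) \<le> card q + card (\<Union> (set qs))"
    by (rule card_Un_le)
  with Cons.IH Cons.prems[of q] Cons.prems show ?case
    by fastforce
qed simp

text \<open>
  Covering an odd number of points by sets of size at most two wastes at least one place, and the
  waste occurs in \<open>A\<close> and in \<open>B\<close> separately.
\<close>
lemma two_odd_sets_covered_by_pairs:
  fixes A B :: "'v::finite set"
  assumes "odd (card A)" "odd (card B)"
    and small: "\<And>q. q \<in> set qs \<Longrightarrow> card q \<le> 2"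
    and one_side: "\<And>q. q \<in> set qs \<Longrightarrow> q \<inter> A = {} \<or> q \<inter> B = {}"
    and covered: "\<And>v. v \<in> A \<union> B \<Longrightarrow> 1 \<le> incidences qs v"
  shows "card A + card B < 2 * length qs"
proof -
  define meet where "meet S = filter (\<lambda>q. q \<inter> S \<noteq> {}) qs" for S
  have meet: "card S < 2 * length (meet S)" if "odd (card S)" "S \<subseteq> A \<union> B" for S
  proof -
    have "S \<subseteq> \<Union> (set (meet S))"
    proof
      fix v assume "v \<in> S"
      then have "filter (\<lambda>q. v \<in> q) qs \<noteq> []"
        using covered[of v] that(2) by (auto simp: incidences_def)
      then obtain q where "q \<in> set qs" "v \<in> q"
        by (auto simp: filter_empty_conv)
      then show "v \<in> \<Union> (set (meet S))"
        using \<open>v \<in> S\<close> by (auto simp: meet_def)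
    qed
    then have "card S \<le> card (\<Union> (set (meet S)))"
      by (intro card_mono) auto
    also have "\<dots> \<le> 2 * length (meet S)"
      by (rule card_Union_le_twice_length) (auto simp: meet_def small)
    finally show ?thesis using that(1) by (metis dvd_triv_left le_neq_implies_less)
  qed
  have "length (meet A) + length (meet B) \<le> length qs"
    using one_side unfolding meet_def by (induction qs) fastforce+
  with meet[of A] meet[of B] assms(1,2) show ?thesis by auto
qed

text \<open>
  Half as many edges as vertices suffice to cover the configuration fractionally, but not
  integrally. The exponents built from this gap violate normality.
\<close>
lemma hochster_configuration_clique_cover:
  assumes config: "hochster_configuration E c1 c2"
    and small: "\<And>q. q \<in> set qs \<Longrightarrow> card q \<le> 2"
    and clique: "\<And>q x y. \<lbrakk>q \<in> set qs; x \<in> q; y \<in> q; x \<noteq> y\<rbrakk> \<Longrightarrow> {x, y} \<in> E"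
    and covered: "\<And>v. v \<in> set c1 \<union> set c2 \<Longrightarrow> 1 \<le> incidences qs v"
  shows "length c1 + length c2 < 2 * length qs"
proof -
  have "distinct c1" "distinct c2" "odd (length c1)" "odd (length c2)"
    using config by (auto simp: hochster_configuration_def is_cycle_def)
  moreover have "q \<inter> set c1 = {} \<or> q \<inter> set c2 = {}" if "q \<in> set qs" for q
  proof (rule ccontr)
    assume "\<not> ?thesis"
    then obtain x y where "x \<in> q" "x \<in> set c1" "y \<in> q" "y \<in> set c2" by blast
    moreover from this have "{y, x} \<in> E"
      using clique[OF that, of y x] hochster_configuration_disjoint[OF config] by blast
    ultimately have "set c1 \<inter> neighbours E (set c2) \<noteq> {}"
      by (auto simp: neighbours_def)
    then show False
      using config by (simp add: hochster_configuration_def)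
  qed
  ultimately show ?thesis
    using two_odd_sets_covered_by_pairs[of "set c1" "set c2" qs] small covered
    by (simp add: distinct_card)
qed

lemma incidences_map2_pairs:
  assumes "length xs = length ys" "\<And>e. e \<in> set (map2 (\<lambda>x y. {x, y}) xs ys) \<Longrightarrow> card e = 2"
  shows "incidences (map2 (\<lambda>x y. {x, y}) xs ys) v = count_list xs v + count_list ys v"
  using assms
proof (induction xs ys rule: list_induct2)
  case (Cons x xs y ys)
  then have "card {x, y} = 2" by simp
  then have "x \<noteq> y" by auto
  with Cons show ?case by auto
qed simp

lemma count_list_distinct: "distinct xs \<Longrightarrow> count_list xs v = of_bool (v \<in> set xs)"
  by (induction xs) auto

lemma cycle_edge_list:
  assumes "simple_graph E" "is_cycle E c"
  shows "\<exists>es. set es \<subseteq> E \<and> length es = length c \<and> (\<forall>v. incidences es v = 2 * of_bool (v \<in> set c))"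
proof -
  define es where "es = map2 (\<lambda>x y. {x, y}) c (rotate1 c)"
  have "es = map (\<lambda>i. {c ! i, c ! (Suc i mod length c)}) [0..<length c]"
    by (rule nth_equalityI) (simp_all add: es_def nth_rotate1)
  then have "set es \<subseteq> cycle_edges c"
    by (auto simp: cycle_edges_def)
  then have "set es \<subseteq> E"
    using assms(2) by (auto simp: is_cycle_def)
  moreover from this have "incidences es v = count_list c v + count_list (rotate1 c) v" for v
    using assms(1) unfolding es_def by (intro incidences_map2_pairs) (auto simp: simple_graph_def)
  then have "incidences es v = 2 * of_bool (v \<in> set c)" for v
    using assms(2) by (simp add: is_cycle_def count_list_distinct)
  moreover have "length es = length c" by (simp add: es_def)
  ultimately show ?thesis by blast
qed

text \<open>
  The edges of the two cycles, taken together, cover every vertex of the configuration twice.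
  Halving this list is the fractional solution.
\<close>
lemma hochster_configuration_edge_list:
  assumes "simple_graph E" "hochster_configuration E c1 c2"
  obtains k es where "k \<ge> 1" "length c1 + length c2 = 2 * k" "set es \<subseteq> E" "length es = 2 * k"
    "\<And>v. incidences es v = 2 * of_bool (v \<in> set c1 \<union> set c2)"
proof -
  have config: "is_cycle E c1" "is_cycle E c2" "odd (length c1)" "odd (length c2)"
    using assms(2) by (auto simp: hochster_configuration_def)
  then have "even (length c1 + length c2)" "length c1 \<ge> 3"
    by (simp_all add: is_cycle_def)
  obtain k where k: "length c1 + length c2 = 2 * k"
    using \<open>even (length c1 + length c2)\<close> by (rule evenE)
  then have "k \<ge> 1"
    using \<open>length c1 \<ge> 3\<close> by simp
  obtain es1 es2
    where "set es1 \<subseteq> E" "length es1 = length c1" "\<And>v. incidences es1 v = 2 * of_bool (v \<in> set c1)"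
      and "set es2 \<subseteq> E" "length es2 = length c2" "\<And>v. incidences es2 v = 2 * of_bool (v \<in> set c2)"
    using cycle_edge_list[OF assms(1)] config by metis
  then show thesis
    using k \<open>k \<ge> 1\<close> hochster_configuration_disjoint[OF assms(2)] by (intro that[of k "es1 @ es2"]) auto
qed

section \<open>Edge ideals\<close>

text \<open>
  A monomial lies in the \<open>n\<close>-th power of the edge ideal if its exponents are capacities that admit
  \<open>n\<close> edges. The weights that occur in the combinatorial core have value at least \<open>2\<close> on all
  generators, so membership in the integral closure supplies exactly its hypothesis.
\<close>
theorem normal_edge_ideal:
  fixes E :: "'v::finite set set"
  assumes E: "simple_graph E" and no_config: "\<nexists>c1 c2. hochster_configuration E c1 c2"
  shows "normal_ideal (edge_ideal E :: ('v, 'k::field) polyring set)"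
  unfolding edge_ideal_eq_monomial_ideal
proof (rule squarefree_ideal_normalI)
  fix n :: nat and b :: "'v \<Rightarrow> nat"
  assume b: "\<And>w N. (\<And>S. S \<in> E \<Longrightarrow> N \<le> sum w S) \<Longrightarrow> n * N \<le> (\<Sum>v\<in>UNIV. w v * b v)"
  show "\<exists>es. set es \<subseteq> E \<and> length es = n \<and> (\<forall>v. incidences es v \<le> b v)"
  proof (rule integral_matching_if_half_integral_covers_large[OF E no_config])
    fix w :: "'v \<Rightarrow> nat" assume w: "\<And>u v. {u, v} \<in> E \<Longrightarrow> 2 \<le> w u + w v"
    have "2 \<le> sum w e" if "e \<in> E" for e
    proof -
      obtain u v where "e = {u, v}" "u \<noteq> v"
        using E \<open>e \<in> E\<close> by (auto simp: simple_graph_def card_2_iff)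
      then show ?thesis using w[of u v] \<open>e \<in> E\<close> by simp
    qed
    then show "2 * n \<le> (\<Sum>v\<in>UNIV. w v * b v)"
      using b[of 2 w] by (simp add: mult.commute)
  qed
qed

text \<open>
  The product of the variables on the configuration is integral over the \<open>k\<close>-th power, where \<open>2k\<close>
  is the number of these variables. If it belonged to that power, the \<open>k\<close> edges would
  match the configuration perfectly.
\<close>
theorem not_normal_edge_ideal:
  fixes E :: "'v::finite set set"
  assumes E: "simple_graph E" and config: "hochster_configuration E c1 c2"
  shows "\<not> normal_ideal (edge_ideal E :: ('v, 'k::field) polyring set)"
  unfolding edge_ideal_eq_monomial_ideal
proof -
  define D where "D = set c1 \<union> set c2"
  obtain k es where k: "k \<ge> 1" "length c1 + length c2 = 2 * k" and es: "set es \<subseteq> E" "length es = 2 * k"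
    "\<And>v. incidences es v = 2 * of_bool (v \<in> D)"
    using hochster_configuration_edge_list[OF E config] unfolding D_def by blast
  show "\<not> normal_ideal (monomial_ideal (indicator_exponent ` E) :: ('v, 'k) polyring set)"
  proof (rule squarefree_ideal_not_normalI[OF k(1) es])
    fix qs assume qs: "set qs \<subseteq> E" "length qs = k"
    show "\<exists>v. of_bool (v \<in> D) < incidences qs v"
    proof (rule ccontr)
      assume "\<not> ?thesis"
      then have le: "incidences qs v \<le> of_bool (v \<in> D)" for v
        by (meson not_le)
      \<comment> \<open>Both sides of the inequality sum to \<open>2k\<close>, so it is an equality at every vertex.\<close>
      have "card D = 2 * k"
        using config k(2) hochster_configuration_disjoint[OF config]
        by (simp add: D_def card_Un_disjoint hochster_configuration_def is_cycle_def distinct_card)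
      then have "(\<Sum>v\<in>UNIV. incidences qs v) = (\<Sum>v\<in>UNIV. of_bool (v \<in> D))"
        by (simp add: sum_incidences_edges[OF E qs(1)] qs(2) sum_of_bool_eq)
      then have "incidences qs v = of_bool (v \<in> D)" for v
        by (rule sum_mono_inv) (use le in auto)
      then have "1 \<le> incidences qs v" if "v \<in> set c1 \<union> set c2" for v
        using that unfolding D_def[symmetric] by simp
      moreover have card_q: "card q = 2" if "q \<in> set qs" for q
        using E qs(1) that by (auto simp: simple_graph_def)
      moreover have "{x, y} \<in> E" if "q \<in> set qs" "x \<in> q" "y \<in> q" "x \<noteq> y" for q x y
      proof -
        have "{x, y} = q"
          using that card_q[OF that(1)] by (intro card_subset_eq) auto
        then show ?thesis using that(1) qs(1) by blast
      qed
      ultimately show False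
        using hochster_configuration_clique_cover[OF config, of qs] k(2) qs(2) by simp
    qed
  qed
qed

section \<open>Cover ideals of graphs without three independent vertices\<close>

lemma simple_graph_complement_graph: "simple_graph (complement_graph G)"
  by (auto simp: simple_graph_def complement_graph_def)

lemma vertex_cover_iff_independent_Compl: "vertex_cover G C \<longleftrightarrow> independent_set G (- C)"
  by (auto simp: vertex_cover_def independent_set_def)

lemma card_independent_set_le: "independent_set G A \<Longrightarrow> card A \<le> independence_number G"
  unfolding independence_number_def by (intro Max_ge) auto

lemma independent_set_clique:
  assumes "independent_set G A" "x \<in> A" "y \<in> A" "x \<noteq> y"
  shows "{x, y} \<in> complement_graph G"
proof -
  have "{x, y} \<notin> G"
    using assms by (auto simp: independent_set_def)
  then show ?thesis
    unfolding complement_graph_def using assms(4) by blast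
qed

text \<open>
  A smaller cover would leave three independent vertices outside.
\<close>
lemma minimal_vertex_cover_Compl_edge:
  assumes "simple_graph G" "independence_number G \<le> 2" "e \<in> complement_graph G"
  shows "minimal_vertex_cover G (- e)"
proof -
  have e: "card e = 2" "e \<notin> G"
    using assms(3) by (auto simp: complement_graph_def)
  have "\<not> g \<subseteq> e" if "g \<in> G" for g
    using that e assms(1) card_subset_eq[of e g] by (auto simp: simple_graph_def)
  then have "vertex_cover G (- e)"
    by (simp add: vertex_cover_iff_independent_Compl independent_set_def)
  moreover have "\<not> vertex_cover G D" if "D \<subset> - e" for D
  proof
    assume "vertex_cover G D"
    then have "card (- D) \<le> 2"
      using card_independent_set_le[of G "- D"] assms(2) by (simp add: vertex_cover_iff_independent_Compl)
    moreover have "card e < card (- D)"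
      using that by (intro psubset_card_mono) auto
    ultimately show False using e(1) by simp
  qed
  ultimately show ?thesis by (simp add: minimal_vertex_cover_def)
qed

lemma minimal_vertex_cover_avoiding_vertex:
  assumes "simple_graph G"
  shows "\<exists>C. minimal_vertex_cover G C \<and> v \<notin> C"
proof -
  have "\<not> g \<subseteq> {v}" if "g \<in> G" for g
    using that assms card_mono[of "{v}" g] by (auto simp: simple_graph_def)
  then have "vertex_cover G (- {v})"
    by (simp add: vertex_cover_iff_independent_Compl independent_set_def)
  then obtain C where "C \<subseteq> - {v}" "vertex_cover G C" "\<And>D. D \<subseteq> - {v} \<Longrightarrow> vertex_cover G D \<Longrightarrow> D \<subseteq> C \<Longrightarrow> C = D"
    using finite_has_minimal2[of "{D. vertex_cover G D}" "- {v}"] by auto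
  then have "minimal_vertex_cover G C \<and> v \<notin> C"
    unfolding minimal_vertex_cover_def by blast
  then show ?thesis by blast
qed

text \<open>
  What a minimal cover leaves out is an edge of the complement, a single vertex or empty.
\<close>
lemma sum_minimal_vertex_cover_ge:
  fixes u :: "'v::finite \<Rightarrow> nat"
  assumes "independence_number G \<le> 2" and u: "\<And>v. u v \<le> 2" "\<And>x y. {x, y} \<in> complement_graph G \<Longrightarrow> u x + u y \<le> 2"
    and C: "minimal_vertex_cover G C"
  shows "(\<Sum>v\<in>UNIV. u v) - 2 \<le> sum u C"
proof -
  have ind: "independent_set G (- C)"
    using C by (simp add: minimal_vertex_cover_def vertex_cover_iff_independent_Compl)
  then have "card (- C) \<le> 2"
    using card_independent_set_le assms(1) le_trans by blast
  then consider "card (- C) = 0" | "card (- C) = 1" | "card (- C) = 2" by linarith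
  then have "sum u (- C) \<le> 2"
  proof cases
    case 3
    then obtain x y where "- C = {x, y}" "x \<noteq> y"
      by (auto simp: card_2_iff)
    then show ?thesis
      using u(2)[of x y] independent_set_clique[OF ind, of x y] by simp
  qed (auto simp: card_1_singleton_iff u(1))
  moreover have "(\<Sum>v\<in>UNIV. u v) = sum u C + sum u (- C)"
    by (subst sum.union_disjoint[symmetric]) auto
  ultimately show ?thesis by simp
qed

lemma incidences_replicate: "incidences (replicate n e) v = n * of_bool (v \<in> e)"
  by (induction n) auto

lemma singleton_list_with_incidences:
  fixes r :: "'v::finite \<Rightarrow> nat"
  shows "\<exists>qs. set qs \<subseteq> range (\<lambda>v. {v}) \<and> length qs = sum r S \<and> (\<forall>v. incidences qs v = of_bool (v \<in> S) * r v)"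
  using finite[of S]
proof (induction S rule: finite_induct)
  case (insert x S)
  then obtain qs where "set qs \<subseteq> range (\<lambda>v. {v})" "length qs = sum r S" "\<And>v. incidences qs v = of_bool (v \<in> S) * r v"
    by blast
  with insert.hyps show ?case
    by (intro exI[of _ "replicate (r x) {x} @ qs"]) (auto simp: incidences_replicate)
qed (auto intro: exI[of _ "[]"])

lemma incidences_map_disjoint:
  assumes "\<And>q. q \<in> set qs \<Longrightarrow> f q \<inter> q = {}"
  shows "incidences (map f qs) v + incidences qs v \<le> length qs"
  using assms by (induction qs) fastforce+

lemma incidences_map_uminus: "incidences (map uminus qs) v = length qs - incidences qs v"
proof -
  have "incidences (map uminus qs) v + incidences qs v = length qs"
    by (induction qs) auto
  then show ?thesis by simp
qed

text \<open>
  Passing to complements turns covers into cliques of the complement graph, which have at most two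
  vertices. The exponents \<open>b\<close> belong to the \<open>n\<close>-th power if \<open>n\<close> such cliques cover each vertex \<open>v\<close>
  at least \<open>d v = n - b v\<close> times. As in Gallai's identity, \<open>N\<close> edges within the capacities \<open>d\<close>,
  completed by single vertices, cover this demand with \<open>(\<Sum>v. d v) - N\<close> cliques. So the task is again
  to find many edges. If a weight \<open>w\<close> violated the hypothesis of the combinatorial core, then
  \<open>2 - w\<close>, restricted to the vertices with positive demand, would be a weight that
  excludes \<open>b\<close> from the integral closure.
\<close>
theorem normal_cover_ideal:
  fixes G :: "'v::finite set set"
  assumes G: "simple_graph G" "independence_number G \<le> 2"
    and no_config: "\<nexists>c1 c2. hochster_configuration (complement_graph G) c1 c2"
  shows "normal_ideal (cover_ideal G :: ('v, 'k::field) polyring set)"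
  unfolding cover_ideal_eq_monomial_ideal
proof (rule squarefree_ideal_normalI)
  fix n :: nat and b :: "'v \<Rightarrow> nat"
  assume b: "\<And>u N. (\<And>C. C \<in> {C. minimal_vertex_cover G C} \<Longrightarrow> N \<le> sum u C) \<Longrightarrow> n * N \<le> (\<Sum>v\<in>UNIV. u v * b v)"
  let ?H = "complement_graph G"
  define d where "d v = n - b v" for v
  define N where "N = (\<Sum>v\<in>UNIV. d v) - n"
  have "\<exists>es. set es \<subseteq> ?H \<and> length es = N \<and> (\<forall>v. incidences es v \<le> d v)"
  proof (rule integral_matching_if_half_integral_covers_large[OF simple_graph_complement_graph no_config])
    fix w :: "'v \<Rightarrow> nat"
    assume w: "\<And>v. w v \<le> 2" "\<And>u v. {u, v} \<in> ?H \<Longrightarrow> 2 \<le> w u + w v"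
    \<comment> \<open>Outside the support of \<open>d\<close> the exponent \<open>b v\<close> may exceed \<open>n\<close>, and the weight has to vanish there for \<open>b v + d v = n\<close> to be applicable.\<close>
    define u where "u v = (if d v > 0 then 2 - w v else 0)" for v
    define s where "s = (\<Sum>v\<in>UNIV. u v)"
    have "u x + u y \<le> 2" if "{x, y} \<in> ?H" for x y
      using w(1)[of x] w(1)[of y] w(2)[OF that] by (auto simp: u_def)
    then have "s - 2 \<le> sum u C" if "minimal_vertex_cover G C" for C
      unfolding s_def using that G(2) by (intro sum_minimal_vertex_cover_ge) (auto simp: u_def)
    then have "n * (s - 2) \<le> (\<Sum>v\<in>UNIV. u v * b v)"
      by (intro b) auto
    moreover have "(\<Sum>v\<in>UNIV. u v * b v) + (\<Sum>v\<in>UNIV. u v * d v) = n * s"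
    proof -
      have "u v * b v + u v * d v = n * u v" for v
        by (auto simp: u_def d_def simp flip: add_mult_distrib2)
      then show ?thesis
        by (simp add: s_def sum_distrib_left flip: sum.distrib)
    qed
    moreover have "n * s \<le> n * (s - 2) + 2 * n"
      by (cases "s \<le> 2") (auto simp: algebra_simps diff_mult_distrib2)
    ultimately have "(\<Sum>v\<in>UNIV. u v * d v) \<le> 2 * n" by linarith
    moreover have "(\<Sum>v\<in>UNIV. w v * d v) + (\<Sum>v\<in>UNIV. u v * d v) = 2 * (\<Sum>v\<in>UNIV. d v)"
    proof -
      have "w v * d v + u v * d v = 2 * d v" for v
        using w(1)[of v] by (auto simp: u_def simp flip: add_mult_distrib)
      then show ?thesis
        by (simp add: sum_distrib_left flip: sum.distrib)
    qed
    ultimately show "2 * N \<le> (\<Sum>v\<in>UNIV. w v * d v)"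
      unfolding N_def by linarith
  qed
  then obtain es where es: "set es \<subseteq> ?H" "length es = N" "\<And>v. incidences es v \<le> d v"
    by blast
  obtain ss where ss: "set ss \<subseteq> range (\<lambda>v. {v})" "length ss = (\<Sum>v\<in>UNIV. d v - incidences es v)"
    "\<And>v. incidences ss v = d v - incidences es v"
    using singleton_list_with_incidences[of "\<lambda>v. d v - incidences es v" UNIV] by auto
  have "length ss + (\<Sum>v\<in>UNIV. incidences es v) = (\<Sum>v\<in>UNIV. d v)"
    unfolding ss(2) sum.distrib[symmetric] using es(3) by simp
  then have len: "length (es @ ss) \<le> n"
    using sum_incidences_edges[OF simple_graph_complement_graph es(1)] es(2) by (simp add: N_def)
  \<comment> \<open>Any further cliques may fill up the list to length \<open>n\<close>.\<close>
  define qs where "qs = es @ ss @ replicate (n - length (es @ ss)) {undefined}"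
  have "length qs = n"
    using len by (simp add: qs_def)
  have qs: "q \<in> ?H \<or> q \<in> range (\<lambda>v. {v})" if "q \<in> set qs" for q
    using that es(1) ss(1) by (auto simp: qs_def split: if_splits)
  have "\<exists>C. minimal_vertex_cover G C \<and> C \<inter> q = {}" if "q \<in> set qs" for q
    using qs[OF that] minimal_vertex_cover_Compl_edge[OF G, of q] minimal_vertex_cover_avoiding_vertex[OF G(1)]
    by blast
  then obtain f where f: "\<And>q. q \<in> set qs \<Longrightarrow> minimal_vertex_cover G (f q) \<and> f q \<inter> q = {}"
    by metis
  have "incidences (map f qs) v \<le> b v" for v
  proof -
    have "incidences (map f qs) v + incidences qs v \<le> n"
      using incidences_map_disjoint[of qs f v] f \<open>length qs = n\<close> by simp
    moreover have "d v \<le> incidences qs v"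
      using es(3)[of v] ss(3)[of v] by (simp add: qs_def)
    ultimately show ?thesis by (simp add: d_def)
  qed
  then show "\<exists>Cs. set Cs \<subseteq> {C. minimal_vertex_cover G C} \<and> length Cs = n \<and> (\<forall>v. incidences Cs v \<le> b v)"
    using f \<open>length qs = n\<close> by (intro exI[of _ "map f qs"]) auto
qed

text \<open>
  The exponents are \<open>k - 1\<close> on the configuration and \<open>k\<close> elsewhere, where \<open>2k\<close> is the number of
  vertices of the configuration. Doubled, they are the sum over the \<open>2k\<close> complements of cycle edges.
  Undoubled, \<open>k\<close> minimal covers below them would have complements that cover the configuration.
\<close>
theorem not_normal_cover_ideal:
  fixes G :: "'v::finite set set"
  assumes G: "simple_graph G" "independence_number G \<le> 2"
    and config: "hochster_configuration (complement_graph G) c1 c2"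
  shows "\<not> normal_ideal (cover_ideal G :: ('v, 'k::field) polyring set)"
  unfolding cover_ideal_eq_monomial_ideal
proof -
  let ?H = "complement_graph G"
  define D where "D = set c1 \<union> set c2"
  obtain k es where k: "k \<ge> 1" "length c1 + length c2 = 2 * k" and es: "set es \<subseteq> ?H" "length es = 2 * k"
    "\<And>v. incidences es v = 2 * of_bool (v \<in> D)"
    using hochster_configuration_edge_list[OF simple_graph_complement_graph config]
    unfolding D_def by blast
  show "\<not> normal_ideal (monomial_ideal (indicator_exponent ` {C. minimal_vertex_cover G C}) :: ('v, 'k) polyring set)"
  proof (rule squarefree_ideal_not_normalI[OF k(1)])
    show "set (map uminus es) \<subseteq> {C. minimal_vertex_cover G C}"
      using es(1) minimal_vertex_cover_Compl_edge[OF G] by auto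
    show "length (map uminus es) = 2 * k"
      by (simp add: es(2))
    show "incidences (map uminus es) v = 2 * (k - of_bool (v \<in> D))" for v
      by (simp add: incidences_map_uminus es(2,3) diff_mult_distrib2)
  next
    fix Cs assume Cs: "set Cs \<subseteq> {C. minimal_vertex_cover G C}" "length Cs = k"
    have independent: "independent_set G q" if "q \<in> set (map uminus Cs)" for q
      using that Cs(1) by (auto simp: minimal_vertex_cover_def vertex_cover_iff_independent_Compl)
    show "\<exists>v. k - of_bool (v \<in> D) < incidences Cs v"
    proof (rule ccontr)
      assume "\<not> ?thesis"
      then have le: "incidences Cs v \<le> k - of_bool (v \<in> D)" for v
        by (meson not_le)
      have "length c1 + length c2 < 2 * length (map uminus Cs)"
      proof (rule hochster_configuration_clique_cover[OF config])
        show "card q \<le> 2" if "q \<in> set (map uminus Cs)" for q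
          using card_independent_set_le[OF independent[OF that]] G(2) by simp
        show "{x, y} \<in> ?H" if "q \<in> set (map uminus Cs)" "x \<in> q" "y \<in> q" "x \<noteq> y" for q x y
          using independent_set_clique[OF independent[OF that(1)] that(2-4)] .
        show "1 \<le> incidences (map uminus Cs) v" if "v \<in> set c1 \<union> set c2" for v
          using le[of v] that k(1) by (simp add: incidences_map_uminus Cs(2) flip: D_def)
      qed
      then show False using k(2) Cs(2) by simp
    qed
  qed
qed

theorem theorem5p11:
  fixes G :: "'v::finite set set"
  assumes "simple_graph G"
    and "independence_number G \<le> 2"
  shows "(normal_ideal (cover_ideal G :: ('v, 'k::field) polyring set) \<longleftrightarrow>
            normal_ideal (edge_ideal (complement_graph G) :: ('v, 'k) polyring set)) \<and>
         (normal_ideal (cover_ideal G :: ('v, 'k) polyring set) \<longleftrightarrow>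
            \<not> (\<exists>c1 c2. hochster_configuration (complement_graph G) c1 c2))"
proof (cases "\<exists>c1 c2. hochster_configuration (complement_graph G) c1 c2")
  case True
  then show ?thesis
    using not_normal_cover_ideal[OF assms] not_normal_edge_ideal[OF simple_graph_complement_graph] by blast
next
  case False
  then show ?thesis
    using normal_cover_ideal[OF assms] normal_edge_ideal[OF simple_graph_complement_graph] by blast
qed

end
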